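(* Let $A, B, C$ be rings, let $f: A\to B$ and $g: A\to C$ be ring homomorphisms, and let $J$ be an ideal of $B$ and $J'$ an ideal of $C$ such that $f^{-1}(J)=g^{-1}(J')$. Assume that $J\times J'$ is a regular ideal of the ring $(f(A)+J)\times (g(A)+J')$. Then: (i) $A\bowtie^{f,g}(J,J')$ is a Gaussian ring if and only if $J=B$, $J'=C$, and both $B$ and $C$ are Gaussian rings; (ii) $A\bowtie^{f,g}(J,J')$ is a Prüfer ring if and only if $J=B$, $J'=C$, and both $B$ and $C$ are Prüfer rings.
   Context: All rings are commutative with identity. Here $f(A)+J=\{f(a)+j : a\in A, j\in J\}$ is a subring of $B$ and $g(A)+J'=\{g(a)+j' : a\in A, j'\in J'\}$ is a subring of $C$. Bi-amalgamation: for ring homomorphisms $f:A\to B$, $g:A\to C$ and ideals $J\subseteq B$, $J'\subseteq C$ with $f^{-1}(J)=g^{-1}(J')$, the bi-amalgamation of $A$ with $(B,C)$ along $(J,J')$ with respect to $(f,g)$ is the subring of $B\times C$ $$A\bowtie^{f,g}(J,J'):=\{(f(a)+j,\,g(a)+j') : a\in A,\ (j,j')\in J\times J'\}.$$ An element of a ring is regular if it is not a zero-divisor; an ideal is regular if it contains a regular element. A ring $R$ is Gaussian if $c(pq)=c(p)c(q)$ for all $p,q\in R[X]$, where the content $c(p)$ is the ideal of $R$ generated by the coefficients of $p$. A ring $R$ is Prüfer if every finitely generated regular ideal of $R$ is invertible (as a fractional ideal in the total ring of quotients of $R$). *)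

theory Defs
  imports "HOL-Algebra.Algebra"
begin

section \<open>Regular elements and regular ideals\<close>

definition zero_divisor :: "('a, 'm) ring_scheme \<Rightarrow> 'a \<Rightarrow> bool" where
  "zero_divisor R x \<longleftrightarrow>
     x \<in> carrier R \<and> (\<exists>y \<in> carrier R. y \<noteq> \<zero>\<^bsub>R\<^esub> \<and> x \<otimes>\<^bsub>R\<^esub> y = \<zero>\<^bsub>R\<^esub>)"

definition regular_elements :: "('a, 'm) ring_scheme \<Rightarrow> 'a set" where
  "regular_elements R = {x \<in> carrier R. \<not> zero_divisor R x}"

definition regular_ideal :: "('a, 'm) ring_scheme \<Rightarrow> 'a set \<Rightarrow> bool" where
  "regular_ideal R I \<longleftrightarrow> ideal I R \<and> I \<inter> regular_elements R \<noteq> {}"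

definition finitely_generated_ideal :: "('a, 'm) ring_scheme \<Rightarrow> 'a set \<Rightarrow> bool" where
  "finitely_generated_ideal R I \<longleftrightarrow>
     (\<exists>S. finite S \<and> S \<subseteq> carrier R \<and> I = Idl\<^bsub>R\<^esub> S)"


section \<open>The total ring of quotients\<close>

definition frac_rel :: "('a, 'm) ring_scheme \<Rightarrow> (('a \<times> 'a) \<times> ('a \<times> 'a)) set" where
  "frac_rel R = {((a, s), (b, t)).
     a \<in> carrier R \<and> s \<in> regular_elements R \<and> b \<in> carrier R \<and> t \<in> regular_elements R \<and>
     a \<otimes>\<^bsub>R\<^esub> t = b \<otimes>\<^bsub>R\<^esub> s}"

definition fraction :: "('a, 'm) ring_scheme \<Rightarrow> 'a \<Rightarrow> 'a \<Rightarrow> ('a \<times> 'a) set" where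
  "fraction R a s = frac_rel R `` {(a, s)}"

text \<open>
  The unions below are the usual way to lift an operation to equivalence classes: all members of
  the union coincide (see \<open>mult_frac\<close>, \<open>add_frac\<close> and \<open>smult_frac\<close>). The record type is that of
  modules, so that the total ring of quotients is a ring and a module over \<open>R\<close> at once.
\<close>

definition total_quotient_ring :: "('a, 'm) ring_scheme \<Rightarrow> ('a, ('a \<times> 'a) set) module" where
  "total_quotient_ring R =
    \<lparr> carrier = (carrier R \<times> regular_elements R) // frac_rel R,
      monoid.mult = (\<lambda>x y. \<Union>(a, s) \<in> x. \<Union>(b, t) \<in> y. fraction R (a \<otimes>\<^bsub>R\<^esub> b) (s \<otimes>\<^bsub>R\<^esub> t)),
      monoid.one = fraction R \<one>\<^bsub>R\<^esub> \<one>\<^bsub>R\<^esub>,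
      ring.zero = fraction R \<zero>\<^bsub>R\<^esub> \<one>\<^bsub>R\<^esub>,
      ring.add = (\<lambda>x y. \<Union>(a, s) \<in> x. \<Union>(b, t) \<in> y.
               fraction R (a \<otimes>\<^bsub>R\<^esub> t \<oplus>\<^bsub>R\<^esub> b \<otimes>\<^bsub>R\<^esub> s) (s \<otimes>\<^bsub>R\<^esub> t)),
      module.smult = (\<lambda>r x. \<Union>(a, s) \<in> x. fraction R (r \<otimes>\<^bsub>R\<^esub> a) s) \<rparr>"

definition to_quotient :: "('a, 'm) ring_scheme \<Rightarrow> 'a \<Rightarrow> ('a \<times> 'a) set" where
  "to_quotient R r = fraction R r \<one>\<^bsub>R\<^esub>"

context cring
begin

lemma regular_iff:
  "x \<in> regular_elements R \<longleftrightarrow>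
     x \<in> carrier R \<and> (\<forall>y \<in> carrier R. x \<otimes> y = \<zero> \<longrightarrow> y = \<zero>)"
  unfolding regular_elements_def zero_divisor_def by auto

lemma regular_closed: "x \<in> regular_elements R \<Longrightarrow> x \<in> carrier R"
  by (simp add: regular_iff)

lemma regular_one: "\<one> \<in> regular_elements R"
  by (simp add: regular_iff)

lemma regular_mult:
  "x \<in> regular_elements R \<Longrightarrow> y \<in> regular_elements R \<Longrightarrow> x \<otimes> y \<in> regular_elements R"
  unfolding regular_iff by (metis m_assoc m_closed)

lemma regular_cancel:
  assumes s: "s \<in> regular_elements R" and ab: "a \<in> carrier R" "b \<in> carrier R"
    and eq: "s \<otimes> a = s \<otimes> b"
  shows "a = b"
proof -
  have sc: "s \<in> carrier R" using s by (rule regular_closed)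
  have "s \<otimes> (a \<ominus> b) = \<zero>"
    using sc ab eq by (simp add: minus_eq r_distr r_minus r_neg)
  then have "a \<ominus> b = \<zero>" using s ab by (simp add: regular_iff)
  then show ?thesis using ab by simp
qed

lemma equiv_frac_rel: "equiv (carrier R \<times> regular_elements R) (frac_rel R)"
proof (rule equivI)
  show "frac_rel R \<subseteq> (carrier R \<times> regular_elements R) \<times> (carrier R \<times> regular_elements R)"
    by (auto simp: frac_rel_def)
  show "refl_on (carrier R \<times> regular_elements R) (frac_rel R)"
    by (auto simp: refl_on_def frac_rel_def)
  show "sym (frac_rel R)" by (auto simp: sym_def frac_rel_def)
  show "trans (frac_rel R)"
  proof (rule transI, clarify)
    fix a s b t c u
    assume 1: "((a, s), (b, t)) \<in> frac_rel R" and 2: "((b, t), (c, u)) \<in> frac_rel R"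
    have cl: "a \<in> carrier R" "b \<in> carrier R" "c \<in> carrier R"
      and reg: "s \<in> regular_elements R" "t \<in> regular_elements R" "u \<in> regular_elements R"
      and e1: "a \<otimes> t = b \<otimes> s" and e2: "b \<otimes> u = c \<otimes> t"
      using 1 2 by (auto simp: frac_rel_def)
    note cl' = cl reg[THEN regular_closed]
    have "t \<otimes> (a \<otimes> u) = (a \<otimes> t) \<otimes> u" using cl' by (simp add: m_ac)
    also have "\<dots> = (b \<otimes> u) \<otimes> s" using cl' e1 by (simp add: m_ac)
    also have "\<dots> = t \<otimes> (c \<otimes> s)" using cl' e2 by (simp add: m_ac)
    finally have e: "t \<otimes> (a \<otimes> u) = t \<otimes> (c \<otimes> s)" .
    have "a \<otimes> u = c \<otimes> s"
      by (rule regular_cancel[OF reg(2) _ _ e]) (use cl' in auto)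
    then show "((a, s), (c, u)) \<in> frac_rel R" using cl reg by (simp add: frac_rel_def)
  qed
qed

lemma frac_eq_iff:
  assumes "a \<in> carrier R" "s \<in> regular_elements R" "b \<in> carrier R" "t \<in> regular_elements R"
  shows "fraction R a s = fraction R b t \<longleftrightarrow> a \<otimes> t = b \<otimes> s"
  unfolding fraction_def
  using assms eq_equiv_class_iff[OF equiv_frac_rel, of "(a, s)" "(b, t)"]
  by (auto simp: frac_rel_def)

lemma frac_self:
  "a \<in> carrier R \<Longrightarrow> s \<in> regular_elements R \<Longrightarrow> (a, s) \<in> fraction R a s"
  by (simp add: fraction_def frac_rel_def)

lemma frac_memD:
  assumes "(b, t) \<in> fraction R a s"
  shows "b \<in> carrier R" "t \<in> regular_elements R" "a \<otimes> t = b \<otimes> s"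
  using assms by (auto simp: fraction_def frac_rel_def)

lemma frac_in_carrier:
  "a \<in> carrier R \<Longrightarrow> s \<in> regular_elements R \<Longrightarrow> fraction R a s \<in> carrier (total_quotient_ring R)"
  by (auto simp: total_quotient_ring_def fraction_def intro: quotientI)

lemma total_quotient_cases:
  assumes "x \<in> carrier (total_quotient_ring R)"
  obtains a s where "a \<in> carrier R" "s \<in> regular_elements R" "x = fraction R a s"
  using assms by (auto simp: total_quotient_ring_def fraction_def elim!: quotientE)

lemma mult_frac:
  assumes "a \<in> carrier R" "s \<in> regular_elements R" "b \<in> carrier R" "t \<in> regular_elements R"
  shows "fraction R a s \<otimes>\<^bsub>total_quotient_ring R\<^esub> fraction R b t = fraction R (a \<otimes> b) (s \<otimes> t)"
proof -
  have *: "fraction R (a' \<otimes> b') (s' \<otimes> t') = fraction R (a \<otimes> b) (s \<otimes> t)"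
    if "(a', s') \<in> fraction R a s" "(b', t') \<in> fraction R b t" for a' s' b' t'
  proof -
    note d = frac_memD[OF that(1)] frac_memD[OF that(2)]
    note c = assms(1,3) assms(2,4)[THEN regular_closed] d(1,4) d(2,5)[THEN regular_closed]
    have "(a' \<otimes> b') \<otimes> (s \<otimes> t) = (a' \<otimes> s) \<otimes> (b' \<otimes> t)" using c by (simp add: m_ac)
    also have "\<dots> = (a \<otimes> s') \<otimes> (b \<otimes> t')" using d by simp
    also have "\<dots> = (a \<otimes> b) \<otimes> (s' \<otimes> t')" using c by (simp add: m_ac)
    finally show ?thesis using c d assms by (subst frac_eq_iff) (auto intro: regular_mult)
  qed
  have "fraction R a s \<otimes>\<^bsub>total_quotient_ring R\<^esub> fraction R b t =
      (\<Union>p \<in> fraction R a s. \<Union>q \<in> fraction R b t. fraction R (fst p \<otimes> fst q) (snd p \<otimes> snd q))"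
    by (simp add: total_quotient_ring_def case_prod_beta)
  also have "\<dots> = (\<Union>p \<in> fraction R a s. \<Union>q \<in> fraction R b t. fraction R (a \<otimes> b) (s \<otimes> t))"
    by (intro SUP_cong refl) (metis * prod.collapse)
  also have "\<dots> = fraction R (a \<otimes> b) (s \<otimes> t)"
    using frac_self[OF assms(1,2)] frac_self[OF assms(3,4)] by auto
  finally show ?thesis .
qed

lemma add_frac:
  assumes "a \<in> carrier R" "s \<in> regular_elements R" "b \<in> carrier R" "t \<in> regular_elements R"
  shows "fraction R a s \<oplus>\<^bsub>total_quotient_ring R\<^esub> fraction R b t = fraction R (a \<otimes> t \<oplus> b \<otimes> s) (s \<otimes> t)"
proof -
  have *: "fraction R (a' \<otimes> t' \<oplus> b' \<otimes> s') (s' \<otimes> t') = fraction R (a \<otimes> t \<oplus> b \<otimes> s) (s \<otimes> t)"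
    if "(a', s') \<in> fraction R a s" "(b', t') \<in> fraction R b t" for a' s' b' t'
  proof -
    note d = frac_memD[OF that(1)] frac_memD[OF that(2)]
    note c = assms(1,3) assms(2,4)[THEN regular_closed] d(1,4) d(2,5)[THEN regular_closed]
    have "(a' \<otimes> t' \<oplus> b' \<otimes> s') \<otimes> (s \<otimes> t)
        = (a' \<otimes> s) \<otimes> (t \<otimes> t') \<oplus> (b' \<otimes> t) \<otimes> (s \<otimes> s')"
      using c by (simp add: l_distr r_distr m_ac)
    also have "\<dots> = (a \<otimes> s') \<otimes> (t \<otimes> t') \<oplus> (b \<otimes> t') \<otimes> (s \<otimes> s')" using d by simp
    also have "\<dots> = (a \<otimes> t \<oplus> b \<otimes> s) \<otimes> (s' \<otimes> t')" using c by (simp add: l_distr r_distr m_ac)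
    finally show ?thesis using c d assms by (subst frac_eq_iff) (auto intro: regular_mult)
  qed
  have "fraction R a s \<oplus>\<^bsub>total_quotient_ring R\<^esub> fraction R b t =
      (\<Union>p \<in> fraction R a s. \<Union>q \<in> fraction R b t.
         fraction R (fst p \<otimes> snd q \<oplus> fst q \<otimes> snd p) (snd p \<otimes> snd q))"
    by (simp add: total_quotient_ring_def case_prod_beta)
  also have "\<dots> = (\<Union>p \<in> fraction R a s. \<Union>q \<in> fraction R b t. fraction R (a \<otimes> t \<oplus> b \<otimes> s) (s \<otimes> t))"
    by (intro SUP_cong refl) (metis * prod.collapse)
  also have "\<dots> = fraction R (a \<otimes> t \<oplus> b \<otimes> s) (s \<otimes> t)"
    using frac_self[OF assms(1,2)] frac_self[OF assms(3,4)] by auto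
  finally show ?thesis .
qed

lemma smult_frac:
  assumes "r \<in> carrier R" "a \<in> carrier R" "s \<in> regular_elements R"
  shows "r \<odot>\<^bsub>total_quotient_ring R\<^esub> fraction R a s = fraction R (r \<otimes> a) s"
proof -
  have *: "fraction R (r \<otimes> a') s' = fraction R (r \<otimes> a) s" if "(a', s') \<in> fraction R a s" for a' s'
    using frac_memD[OF that] assms regular_closed
    by (subst frac_eq_iff) (auto simp: m_assoc)
  have "r \<odot>\<^bsub>total_quotient_ring R\<^esub> fraction R a s = (\<Union>p \<in> fraction R a s. fraction R (r \<otimes> fst p) (snd p))"
    by (simp add: total_quotient_ring_def case_prod_beta)
  also have "\<dots> = (\<Union>p \<in> fraction R a s. fraction R (r \<otimes> a) s)"
    by (intro SUP_cong refl) (metis * prod.collapse)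
  also have "\<dots> = fraction R (r \<otimes> a) s" using frac_self[OF assms(2,3)] by auto
  finally show ?thesis .
qed

lemma zero_frac: "\<zero>\<^bsub>total_quotient_ring R\<^esub> = fraction R \<zero> \<one>"
  and one_frac: "\<one>\<^bsub>total_quotient_ring R\<^esub> = fraction R \<one> \<one>"
  by (simp_all add: total_quotient_ring_def)

lemmas frac_arith = mult_frac add_frac smult_frac zero_frac one_frac frac_in_carrier
  regular_mult regular_one regular_closed

lemma total_quotient_cring: "cring (total_quotient_ring R)" (is "cring ?Q")
proof (rule cringI)
  show "abelian_group ?Q"
  proof (rule abelian_groupI)
    fix x assume "x \<in> carrier ?Q"
    then obtain a s where "a \<in> carrier R" "s \<in> regular_elements R" "x = fraction R a s"
      by (rule total_quotient_cases)
    then show "\<exists>y \<in> carrier ?Q. y \<oplus>\<^bsub>?Q\<^esub> x = \<zero>\<^bsub>?Q\<^esub>"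
      by (intro bexI[of _ "fraction R (\<ominus> a) s"]) (auto simp: frac_arith frac_eq_iff l_minus l_neg)
  next
    fix x y z assume "x \<in> carrier ?Q" "y \<in> carrier ?Q" "z \<in> carrier ?Q"
    then show "x \<oplus>\<^bsub>?Q\<^esub> y \<oplus>\<^bsub>?Q\<^esub> z = x \<oplus>\<^bsub>?Q\<^esub> (y \<oplus>\<^bsub>?Q\<^esub> z)"
      by (elim total_quotient_cases) (simp add: frac_arith l_distr r_distr m_ac a_ac)
  next
    fix x y assume "x \<in> carrier ?Q" "y \<in> carrier ?Q"
    then show "x \<oplus>\<^bsub>?Q\<^esub> y = y \<oplus>\<^bsub>?Q\<^esub> x"
      by (elim total_quotient_cases) (simp add: frac_arith m_ac a_ac)
  qed (auto elim!: total_quotient_cases simp: frac_arith)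
  show "comm_monoid ?Q"
    by (rule comm_monoidI) (auto elim!: total_quotient_cases simp: frac_arith m_ac)
  fix x y z assume "x \<in> carrier ?Q" "y \<in> carrier ?Q" "z \<in> carrier ?Q"
  then show "(x \<oplus>\<^bsub>?Q\<^esub> y) \<otimes>\<^bsub>?Q\<^esub> z = x \<otimes>\<^bsub>?Q\<^esub> z \<oplus>\<^bsub>?Q\<^esub> y \<otimes>\<^bsub>?Q\<^esub> z"
    by (elim total_quotient_cases)
      (simp add: frac_arith frac_eq_iff l_distr r_distr m_ac a_ac)
qed

lemma total_quotient_algebra: "algebra R (total_quotient_ring R)" (is "algebra R ?Q")
proof -
  interpret Q: cring ?Q by (rule total_quotient_cring)
  show ?thesis
  proof (rule algebraI)
    show "cring R" "cring ?Q" by (fact is_cring, fact total_quotient_cring)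
  qed (elim total_quotient_cases, simp add: frac_arith frac_eq_iff l_distr r_distr m_ac a_ac)+
qed

lemma to_quotient_hom: "to_quotient R \<in> ring_hom R (total_quotient_ring R)"
  by (rule ring_hom_memI) (auto simp: to_quotient_def frac_arith)

lemma to_quotient_inj: "inj_on (to_quotient R) (carrier R)"
  by (auto simp: inj_on_def to_quotient_def frac_eq_iff regular_one)

lemma to_quotient_smult:
  assumes "r \<in> carrier R" "x \<in> carrier (total_quotient_ring R)"
  shows "r \<odot>\<^bsub>total_quotient_ring R\<^esub> x = to_quotient R r \<otimes>\<^bsub>total_quotient_ring R\<^esub> x"
  using assms by (auto elim!: total_quotient_cases simp: to_quotient_def frac_arith)

lemma to_quotient_regular_unit:
  assumes "s \<in> regular_elements R"
  shows "to_quotient R s \<otimes>\<^bsub>total_quotient_ring R\<^esub> fraction R \<one> s = \<one>\<^bsub>total_quotient_ring R\<^esub>"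
  using assms by (simp add: to_quotient_def frac_arith frac_eq_iff)

lemma frac_eq_quotient:
  assumes "a \<in> carrier R" "s \<in> regular_elements R"
  shows "fraction R a s = to_quotient R a \<otimes>\<^bsub>total_quotient_ring R\<^esub> fraction R \<one> s"
  using assms by (simp add: to_quotient_def frac_arith)

end


section \<open>Invertible ideals and Pruefer rings\<close>

definition fractional_ideal :: "('a, 'm) ring_scheme \<Rightarrow> ('a \<times> 'a) set set \<Rightarrow> bool" where
  "fractional_ideal R K \<longleftrightarrow>
     submodule K R (total_quotient_ring R) \<and>
     (\<exists>d \<in> regular_elements R. \<forall>x \<in> K.
        d \<odot>\<^bsub>total_quotient_ring R\<^esub> x \<in> to_quotient R ` carrier R)"

text \<open>
  Applied to the ring of quotients, \<^const>\<open>ideal_prod\<close> yields the set of finite sums of products of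
  elements of two submodules, which is the product of fractional ideals.
\<close>

definition invertible_fractional_ideal ::
  "('a, 'm) ring_scheme \<Rightarrow> ('a \<times> 'a) set set \<Rightarrow> bool" where
  "invertible_fractional_ideal R I \<longleftrightarrow>
     fractional_ideal R I \<and>
     (\<exists>K. fractional_ideal R K \<and>
          ideal_prod (total_quotient_ring R) I K = to_quotient R ` carrier R)"

definition pruefer_ring :: "('a, 'm) ring_scheme \<Rightarrow> bool" where
  "pruefer_ring R \<longleftrightarrow>
     cring R \<and>
     (\<forall>I. finitely_generated_ideal R I \<and> regular_ideal R I \<longrightarrow>
          invertible_fractional_ideal R (to_quotient R ` I))"


section \<open>Gaussian rings\<close>

definition content_ideal :: "('a, 'm) ring_scheme \<Rightarrow> (nat \<Rightarrow> 'a) \<Rightarrow> 'a set" where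
  "content_ideal R p = Idl\<^bsub>R\<^esub> (range (up_ring.coeff (UP R) p))"

definition gaussian_ring :: "('a, 'm) ring_scheme \<Rightarrow> bool" where
  "gaussian_ring R \<longleftrightarrow>
     cring R \<and>
     (\<forall>p \<in> carrier (UP R). \<forall>q \<in> carrier (UP R).
        content_ideal R (p \<otimes>\<^bsub>UP R\<^esub> q) = ideal_prod R (content_ideal R p) (content_ideal R q))"


section \<open>Bi-amalgamation\<close>

definition bi_amalgamation ::
  "('a, 'k) ring_scheme \<Rightarrow> ('b, 'l) ring_scheme \<Rightarrow> ('c, 'm) ring_scheme \<Rightarrow>
   ('a \<Rightarrow> 'b) \<Rightarrow> ('a \<Rightarrow> 'c) \<Rightarrow> 'b set \<Rightarrow> 'c set \<Rightarrow> ('b \<times> 'c) ring" where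
  "bi_amalgamation A B C f g J J' =
     (RDirProd B C)\<lparr>carrier :=
        {(f a \<oplus>\<^bsub>B\<^esub> j, g a \<oplus>\<^bsub>C\<^esub> j') | a j j'. a \<in> carrier A \<and> j \<in> J \<and> j' \<in> J'}\<rparr>"

definition image_plus_ideal ::
  "('a, 'k) ring_scheme \<Rightarrow> ('b, 'l) ring_scheme \<Rightarrow> ('a \<Rightarrow> 'b) \<Rightarrow> 'b set \<Rightarrow> ('b, 'l) ring_scheme"
  where
  "image_plus_ideal A B f J = B\<lparr>carrier := {f a \<oplus>\<^bsub>B\<^esub> j | a j. a \<in> carrier A \<and> j \<in> J}\<rparr>"

end

theory Submission
  imports Defs
begin

text \<open>
  Let \<open>(j, j')\<close> be a regular element of \<open>J \<times> J'\<close>. The elements \<open>x = (j, 0)\<close> and \<open>y = (0, j')\<close> of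
  the bi-amalgamation satisfy \<open>x y = 0\<close>, and \<open>x + y\<close> is regular. In a Gaussian ring, comparing
  contents in \<open>(x + y X) (y + x X) = (x + y)\<^sup>2 X\<close> shows that \<open>x\<^sup>2\<close> is a multiple of \<open>(x + y)\<^sup>2\<close>;
  in a Pruefer ring, the ideal \<open>(x, y)\<close> is invertible. In both cases one finds an element \<open>e\<close> with
  \<open>e x = x\<close> and \<open>e y = 0\<close>, which can only be \<open>(1, 0)\<close>. So \<open>(1, 0)\<close> lies in the
  bi-amalgamation, which forces \<open>1 \<in> J\<close> and \<open>1 \<in> J'\<close>, and the bi-amalgamation is \<open>B \<times> C\<close>.
  Finally, contents, ideals and their products, and regular elements of \<open>B \<times> C\<close> are computed
  componentwise.
\<close>

section \<open>Invertible ideals without fractions\<close>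

context cring
begin

lemma submodule_to_quotient_image:
  assumes "ideal I R"
  shows "submodule (to_quotient R ` I) R (total_quotient_ring R)"
proof -
  interpret I: ideal I R by fact
  interpret Q: algebra R "total_quotient_ring R" by (rule total_quotient_algebra)
  interpret h: ring_hom_cring R "total_quotient_ring R" "to_quotient R"
    by (intro ring_hom_cringI is_cring total_quotient_cring to_quotient_hom)
  show ?thesis
  proof (rule Q.submoduleI)
    show "to_quotient R ` I \<subseteq> carrier (total_quotient_ring R)"
      using I.Icarr by auto
    show "\<zero>\<^bsub>total_quotient_ring R\<^esub> \<in> to_quotient R ` I"
      by (metis I.zero_closed h.hom_zero imageI)
    show "\<ominus>\<^bsub>total_quotient_ring R\<^esub> a \<in> to_quotient R ` I" if "a \<in> to_quotient R ` I" for a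
      using that I.Icarr by (auto simp flip: h.hom_a_inv)
    show "a \<oplus>\<^bsub>total_quotient_ring R\<^esub> b \<in> to_quotient R ` I"
      if "a \<in> to_quotient R ` I" "b \<in> to_quotient R ` I" for a b
      using that I.Icarr by (auto simp flip: h.hom_add)
    show "a \<odot>\<^bsub>total_quotient_ring R\<^esub> x \<in> to_quotient R ` I"
      if "a \<in> carrier R" "x \<in> to_quotient R ` I" for a x
      using that I.I_l_closed I.Icarr
      by (auto simp: to_quotient_smult simp flip: h.hom_mult)
  qed
qed

lemma fractional_ideal_to_quotient_image:
  assumes "ideal I R"
  shows "fractional_ideal R (to_quotient R ` I)"
proof -
  \<comment> \<open>Elements coming from \<open>R\<close> need no denominator, so
    \<open>\<one>\<close> serves as the common one.\<close>
  have "\<one> \<odot>\<^bsub>total_quotient_ring R\<^esub> x \<in> to_quotient R ` carrier R" if "x \<in> to_quotient R ` I" for x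
  proof -
    from that obtain i where i: "i \<in> I" "x = to_quotient R i" by auto
    have "i \<in> carrier R" using i(1) assms by (simp add: ideal.Icarr)
    then show ?thesis by (simp add: i(2) to_quotient_def smult_frac regular_one)
  qed
  then show ?thesis
    unfolding fractional_ideal_def using submodule_to_quotient_image[OF assms] regular_one by blast
qed

text \<open>If \<open>L\<close> is inverse to the image of \<open>I\<close> and the regular element
  \<open>d\<close> clears the denominators of \<open>L\<close>, then \<open>d L\<close> is an ideal
  \<open>K\<close> of \<open>R\<close>, and \<open>I K = d (I L) = d R\<close>. This expresses
  invertibility inside \<open>R\<close>, where direct products are handled componentwise.\<close>

lemma invertible_imp_principal_product:
  assumes I: "ideal I R" and inv: "invertible_fractional_ideal R (to_quotient R ` I)"
  obtains K d where "ideal K R" "d \<in> regular_elements R" "ideal_prod R I K = PIdl d"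
proof -
  let ?Q = "total_quotient_ring R" and ?\<phi> = "to_quotient R"
  interpret I: ideal I R by fact
  interpret Qc: cring ?Q by (rule total_quotient_cring)
  interpret Q: algebra R ?Q by (rule total_quotient_algebra)
  interpret h: ring_hom_cring R ?Q ?\<phi>
    by (intro ring_hom_cringI is_cring total_quotient_cring to_quotient_hom)
  obtain L where L: "fractional_ideal R L" and IL: "ideal_prod ?Q (?\<phi> ` I) L = ?\<phi> ` carrier R"
    using inv unfolding invertible_fractional_ideal_def by blast
  obtain d where d: "d \<in> regular_elements R"
    and dL: "\<And>x. x \<in> L \<Longrightarrow> d \<odot>\<^bsub>?Q\<^esub> x \<in> ?\<phi> ` carrier R"
    using L unfolding fractional_ideal_def by blast
  have sub: "submodule L R ?Q" using L unfolding fractional_ideal_def by blast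
  note Lsub = Q.submoduleE[OF sub]
  have Lc: "\<And>x. x \<in> L \<Longrightarrow> x \<in> carrier ?Q" using Lsub(1) by blast
  have dc: "d \<in> carrier R" using d by (rule regular_closed)
  have inj: "\<And>a b. ?\<phi> a = ?\<phi> b \<Longrightarrow> a \<in> carrier R \<Longrightarrow> b \<in> carrier R \<Longrightarrow> a = b"
    using to_quotient_inj unfolding inj_on_def by blast
  \<comment> \<open>\<open>K\<close> is the preimage of \<open>d L\<close> under
    \<open>?\<phi>\<close>. By \<open>dL\<close> every element of \<open>d L\<close> comes from
    \<open>R\<close>, so passing to the preimage loses nothing.\<close>
  define K where "K = {r \<in> carrier R. \<exists>x\<in>L. ?\<phi> r = ?\<phi> d \<otimes>\<^bsub>?Q\<^esub> x}"
  have K: "ideal K R"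
  proof (rule idealI)
    show "ring R" by (rule ring_axioms)
    show "subgroup K (add_monoid R)"
    proof (rule add.subgroupI)
      show "K \<subseteq> carrier R" by (auto simp: K_def)
      obtain x where x: "x \<in> L" using Lsub(2) by blast
      obtain r where r: "r \<in> carrier R" "d \<odot>\<^bsub>?Q\<^esub> x = ?\<phi> r" using dL[OF x] by blast
      have "r \<in> K" using r x dc Lc by (auto simp: K_def to_quotient_smult)
      then show "K \<noteq> {}" by blast
      fix a assume a: "a \<in> K"
      then obtain x where x: "x \<in> L" "?\<phi> a = ?\<phi> d \<otimes>\<^bsub>?Q\<^esub> x" "a \<in> carrier R"
        by (auto simp: K_def)
      have "?\<phi> (\<ominus> a) = ?\<phi> d \<otimes>\<^bsub>?Q\<^esub> (\<ominus>\<^bsub>?Q\<^esub> x)" using x Lc dc by (simp add: Qc.r_minus)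
      then show "\<ominus> a \<in> K" using x Lsub(3) by (auto simp: K_def)
      fix b assume "b \<in> K"
      then obtain y where y: "y \<in> L" "?\<phi> b = ?\<phi> d \<otimes>\<^bsub>?Q\<^esub> y" "b \<in> carrier R"
        by (auto simp: K_def)
      have "?\<phi> (a \<oplus> b) = ?\<phi> d \<otimes>\<^bsub>?Q\<^esub> (x \<oplus>\<^bsub>?Q\<^esub> y)" using x y Lc dc by (simp add: Qc.r_distr)
      then show "a \<oplus> b \<in> K" using x y Lsub(5) by (auto simp: K_def)
    qed
    fix a r assume a: "a \<in> K" and r: "r \<in> carrier R"
    then obtain x where x: "x \<in> L" "?\<phi> a = ?\<phi> d \<otimes>\<^bsub>?Q\<^esub> x" "a \<in> carrier R"
      by (auto simp: K_def)
    have "?\<phi> r \<otimes>\<^bsub>?Q\<^esub> x \<in> L" using Lsub(4)[OF r x(1)] r x(1) Lc by (simp add: to_quotient_smult)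
    moreover have "?\<phi> (r \<otimes> a) = ?\<phi> d \<otimes>\<^bsub>?Q\<^esub> (?\<phi> r \<otimes>\<^bsub>?Q\<^esub> x)"
      using x Lc[OF x(1)] dc r by (simp add: Qc.m_ac)
    ultimately show "r \<otimes> a \<in> K" using r x by (auto simp: K_def)
    then show "a \<otimes> r \<in> K" using r x by (simp add: m_comm)
  qed
  have ILc: "\<And>u. u \<in> ideal_prod ?Q (?\<phi> ` I) L \<Longrightarrow> u \<in> carrier ?Q"
    unfolding IL by auto
  have IKc: "\<And>z. z \<in> ideal_prod R I K \<Longrightarrow> z \<in> carrier R"
    using ideal_prod_in_carrier[OF I K] by blast
  \<comment> \<open>Multiplication by \<open>d\<close> takes \<open>I L\<close> onto the image of
    \<open>I K\<close>; \<open>to\<close> and \<open>from_\<close> are the two directions, each by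
    induction on finite sums of products. Injectivity of \<open>?\<phi>\<close> then brings the
    equation back to \<open>R\<close>.\<close>
  have to: "\<exists>u \<in> ideal_prod ?Q (?\<phi> ` I) L. ?\<phi> z = ?\<phi> d \<otimes>\<^bsub>?Q\<^esub> u" if "z \<in> ideal_prod R I K" for z
    using that
  proof induct
    case (prod i k)
    then obtain x where x: "x \<in> L" "?\<phi> k = ?\<phi> d \<otimes>\<^bsub>?Q\<^esub> x" "k \<in> carrier R"
      by (auto simp: K_def)
    have "?\<phi> (i \<otimes> k) = ?\<phi> d \<otimes>\<^bsub>?Q\<^esub> (?\<phi> i \<otimes>\<^bsub>?Q\<^esub> x)"
      using x Lc[OF x(1)] dc I.Icarr[OF prod(1)] by (simp add: Qc.m_ac)
    then show ?case using prod(1) x(1) by (blast intro: ideal_prod.prod)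
  next
    case (sum s t)
    then obtain u v where uv: "u \<in> ideal_prod ?Q (?\<phi> ` I) L" "?\<phi> s = ?\<phi> d \<otimes>\<^bsub>?Q\<^esub> u"
      "v \<in> ideal_prod ?Q (?\<phi> ` I) L" "?\<phi> t = ?\<phi> d \<otimes>\<^bsub>?Q\<^esub> v" by blast
    have "?\<phi> (s \<oplus> t) = ?\<phi> d \<otimes>\<^bsub>?Q\<^esub> (u \<oplus>\<^bsub>?Q\<^esub> v)"
      using uv ILc dc IKc sum by (simp add: Qc.r_distr)
    then show ?case using uv by (blast intro: ideal_prod.sum)
  qed
  have from_: "\<exists>z \<in> ideal_prod R I K. ?\<phi> z = ?\<phi> d \<otimes>\<^bsub>?Q\<^esub> u"
    if "u \<in> ideal_prod ?Q (?\<phi> ` I) L" for u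
    using that
  proof induct
    case (prod u x)
    then obtain i where i: "i \<in> I" "u = ?\<phi> i" by blast
    obtain k where k: "k \<in> carrier R" "d \<odot>\<^bsub>?Q\<^esub> x = ?\<phi> k" using dL[OF prod(2)] by blast
    have k': "?\<phi> k = ?\<phi> d \<otimes>\<^bsub>?Q\<^esub> x" using k dc Lc[OF prod(2)] by (simp add: to_quotient_smult)
    then have "k \<in> K" using k prod(2) by (auto simp: K_def)
    moreover have "?\<phi> (i \<otimes> k) = ?\<phi> d \<otimes>\<^bsub>?Q\<^esub> (u \<otimes>\<^bsub>?Q\<^esub> x)"
      using i k(1) k' Lc[OF prod(2)] dc I.Icarr[OF i(1)] by (simp add: Qc.m_ac)
    ultimately show ?case using i(1) by (blast intro: ideal_prod.prod)
  next
    case (sum u v)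
    then obtain s t where st: "s \<in> ideal_prod R I K" "?\<phi> s = ?\<phi> d \<otimes>\<^bsub>?Q\<^esub> u"
      "t \<in> ideal_prod R I K" "?\<phi> t = ?\<phi> d \<otimes>\<^bsub>?Q\<^esub> v" by blast
    have "?\<phi> (s \<oplus> t) = ?\<phi> d \<otimes>\<^bsub>?Q\<^esub> (u \<oplus>\<^bsub>?Q\<^esub> v)"
      using st ILc dc IKc sum by (simp add: Qc.r_distr)
    then show ?case using st by (blast intro: ideal_prod.sum)
  qed
  have "ideal_prod R I K = PIdl d"
  proof
    show "ideal_prod R I K \<subseteq> PIdl d"
    proof
      fix z assume z: "z \<in> ideal_prod R I K"
      then obtain u where u: "u \<in> ideal_prod ?Q (?\<phi> ` I) L" "?\<phi> z = ?\<phi> d \<otimes>\<^bsub>?Q\<^esub> u"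
        using to by blast
      then obtain r where r: "r \<in> carrier R" "u = ?\<phi> r" using IL by blast
      have "z = r \<otimes> d"
        by (rule inj) (use u r dc IKc[OF z] in \<open>simp_all add: Qc.m_comm\<close>)
      then show "z \<in> PIdl d" using r by (auto simp: cgenideal_def)
    qed
    \<comment> \<open>As \<open>1\<close> lies in \<open>I L\<close>, its multiple \<open>d\<close>
      lies in \<open>I K\<close>.\<close>
    have "?\<phi> \<one> \<in> ideal_prod ?Q (?\<phi> ` I) L" unfolding IL by (intro imageI one_closed)
    then obtain z where z: "z \<in> ideal_prod R I K" "?\<phi> z = ?\<phi> d \<otimes>\<^bsub>?Q\<^esub> ?\<phi> \<one>"
      using from_ by blast
    have "z = d" by (rule inj) (use z dc IKc in simp_all)
    then show "PIdl d \<subseteq> ideal_prod R I K"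
      using z(1) ideal_prod_is_ideal[OF I K] by (simp add: cgenideal_minimal)
  qed
  then show ?thesis using that K d by blast
qed

text \<open>The inverse is \<open>K / d\<close>, since
  \<open>I (K / d) = (I K) / d = d R / d = R\<close>.\<close>

lemma principal_product_imp_invertible:
  assumes I: "ideal I R" and K: "ideal K R" and d: "d \<in> regular_elements R"
    and IK: "ideal_prod R I K = PIdl d"
  shows "invertible_fractional_ideal R (to_quotient R ` I)"
proof -
  let ?Q = "total_quotient_ring R" and ?\<phi> = "to_quotient R"
  interpret I: ideal I R by fact
  interpret K: ideal K R by fact
  interpret Qc: cring ?Q by (rule total_quotient_cring)
  interpret Q: algebra R ?Q by (rule total_quotient_algebra)
  have dc: "d \<in> carrier R" using d by (rule regular_closed)
  \<comment> \<open>\<open>?F\<close> divides by \<open>d\<close>; the facts up to \<open>Fd\<close>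
    record that it is \<open>R\<close>-linear and undoes multiplication by \<open>d\<close>.\<close>
  let ?F = "\<lambda>r. fraction R r d"
  have Fc: "?F r \<in> carrier ?Q" if "r \<in> carrier R" for r
    using that d by (rule frac_in_carrier)
  have F0: "\<zero>\<^bsub>?Q\<^esub> = ?F \<zero>"
    using d dc by (simp add: zero_frac frac_eq_iff regular_one)
  have Fadd: "?F a \<oplus>\<^bsub>?Q\<^esub> ?F b = ?F (a \<oplus> b)" if "a \<in> carrier R" "b \<in> carrier R" for a b
    using that d dc by (simp add: add_frac frac_eq_iff regular_mult l_distr r_distr m_ac)
  have Fsmult: "a \<odot>\<^bsub>?Q\<^esub> ?F b = ?F (a \<otimes> b)" if "a \<in> carrier R" "b \<in> carrier R" for a b
    using that d by (simp add: smult_frac)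
  have Fmult: "?\<phi> a \<otimes>\<^bsub>?Q\<^esub> ?F b = ?F (a \<otimes> b)" if "a \<in> carrier R" "b \<in> carrier R" for a b
    using that d dc by (simp add: to_quotient_def mult_frac regular_one)
  have Fminus: "\<ominus>\<^bsub>?Q\<^esub> ?F a = ?F (\<ominus> a)" if "a \<in> carrier R" for a
    using that Fc F0 by (intro Qc.minus_equality) (simp_all add: Fadd l_neg)
  have Fd: "?F (r \<otimes> d) = ?\<phi> r" if "r \<in> carrier R" for r
    using that d dc by (simp add: to_quotient_def frac_eq_iff regular_one)
  have "submodule (?F ` K) R ?Q"
  proof (rule Q.submoduleI)
    show "?F ` K \<subseteq> carrier ?Q" using K.Icarr Fc by blast
    show "\<zero>\<^bsub>?Q\<^esub> \<in> ?F ` K" using F0 by auto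
    show "\<ominus>\<^bsub>?Q\<^esub> a \<in> ?F ` K" if "a \<in> ?F ` K" for a
      using that K.Icarr by (auto simp: Fminus)
    show "a \<oplus>\<^bsub>?Q\<^esub> b \<in> ?F ` K" if "a \<in> ?F ` K" "b \<in> ?F ` K" for a b
      using that K.Icarr by (auto simp: Fadd)
    show "a \<odot>\<^bsub>?Q\<^esub> x \<in> ?F ` K" if "a \<in> carrier R" "x \<in> ?F ` K" for a x
      using that K.Icarr K.I_l_closed by (auto simp: Fsmult)
  qed
  \<comment> \<open>The element \<open>d\<close> itself is a common denominator of
    \<open>K / d\<close>.\<close>
  moreover have "d \<odot>\<^bsub>?Q\<^esub> x \<in> ?\<phi> ` carrier R" if "x \<in> ?F ` K" for x
    using that K.Icarr dc by (auto simp: Fsmult Fd m_comm[of d])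
  ultimately have frac: "fractional_ideal R (?F ` K)"
    unfolding fractional_ideal_def using d by blast
  have IKc: "\<And>z. z \<in> ideal_prod R I K \<Longrightarrow> z \<in> carrier R"
    using ideal_prod_in_carrier[OF I K] by blast
  have to: "u \<in> ?F ` ideal_prod R I K" if "u \<in> ideal_prod ?Q (?\<phi> ` I) (?F ` K)" for u
    using that
  proof induct
    case (prod u x)
    then show ?case using I.Icarr K.Icarr by (auto simp: Fmult intro!: imageI ideal_prod.prod)
  next
    case (sum u v)
    then show ?case using IKc by (auto simp: Fadd intro!: imageI ideal_prod.sum)
  qed
  have from_: "?F z \<in> ideal_prod ?Q (?\<phi> ` I) (?F ` K)" if "z \<in> ideal_prod R I K" for z
    using that
  proof induct
    case (prod i k)
    have "?\<phi> i \<otimes>\<^bsub>?Q\<^esub> ?F k \<in> ideal_prod ?Q (?\<phi> ` I) (?F ` K)"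
      using prod by (intro ideal_prod.prod imageI)
    then show ?case using prod I.Icarr K.Icarr by (simp add: Fmult)
  next
    case (sum s t)
    have "?F s \<oplus>\<^bsub>?Q\<^esub> ?F t \<in> ideal_prod ?Q (?\<phi> ` I) (?F ` K)"
      using sum by (intro ideal_prod.sum)
    then show ?case using sum IKc by (simp add: Fadd)
  qed
  have "ideal_prod ?Q (?\<phi> ` I) (?F ` K) = ?F ` ideal_prod R I K"
    using to from_ by blast
  also have "\<dots> = ?\<phi> ` carrier R"
    unfolding IK cgenideal_def using Fd by (auto simp: image_iff)
  finally show ?thesis
    unfolding invertible_fractional_ideal_def
    using frac fractional_ideal_to_quotient_image[OF I] by blast
qed

end

text \<open>The two preceding lemmas turn invertibility into an equation between ideals of
  \<open>R\<close>, so that later sections can argue without fractions.\<close>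

lemma pruefer_ring_iff:
  "pruefer_ring R \<longleftrightarrow> cring R \<and>
     (\<forall>S. finite S \<and> S \<subseteq> carrier R \<and> Idl\<^bsub>R\<^esub> S \<inter> regular_elements R \<noteq> {} \<longrightarrow>
        (\<exists>K d. ideal K R \<and> d \<in> regular_elements R \<and> ideal_prod R (Idl\<^bsub>R\<^esub> S) K = PIdl\<^bsub>R\<^esub> d))"
  (is "_ \<longleftrightarrow> cring R \<and> ?P")
proof (cases "cring R")
  case True
  interpret cring R by fact
  have eq: "invertible_fractional_ideal R (to_quotient R ` I) \<longleftrightarrow>
      (\<exists>K d. ideal K R \<and> d \<in> regular_elements R \<and> ideal_prod R I K = PIdl\<^bsub>R\<^esub> d)" if "ideal I R" for I
    using invertible_imp_principal_product[OF that] principal_product_imp_invertible[OF that]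
    by metis
  show ?thesis
    unfolding pruefer_ring_def finitely_generated_ideal_def regular_ideal_def
    using True eq genideal_ideal by metis
qed (simp add: pruefer_ring_def)

section \<open>The Gaussian condition in terms of coefficient sequences\<close>

lemma coeff_UP: "p \<in> carrier (UP R) \<Longrightarrow> up_ring.coeff (UP R) p = p"
  by (auto simp: UP_def)

text \<open>In \<open>UP R\<close> polynomials are eventually zero functions and the product is
  convolution. Unfolding this lets polynomials over a direct product be split
  coefficientwise.\<close>

lemma gaussian_ring_iff:
  "gaussian_ring R \<longleftrightarrow> cring R \<and>
     (\<forall>p \<in> up R. \<forall>q \<in> up R.
        Idl\<^bsub>R\<^esub> (range (\<lambda>n. \<Oplus>\<^bsub>R\<^esub>i \<in> {..n}. p i \<otimes>\<^bsub>R\<^esub> q (n - i))) =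
        ideal_prod R (Idl\<^bsub>R\<^esub> (range p)) (Idl\<^bsub>R\<^esub> (range q)))"
proof (cases "cring R")
  case True
  interpret cring R by fact
  have car: "carrier (UP R) = up R" by (simp add: UP_def)
  have mult: "p \<otimes>\<^bsub>UP R\<^esub> q = (\<lambda>n. \<Oplus>\<^bsub>R\<^esub>i \<in> {..n}. p i \<otimes>\<^bsub>R\<^esub> q (n - i))"
    if "p \<in> up R" "q \<in> up R" for p q
    using that by (simp add: UP_def)
  show ?thesis
    unfolding gaussian_ring_def content_ideal_def
    using True by (simp add: car mult coeff_UP up_mult_closed)
qed (simp add: gaussian_ring_def)


section \<open>Splitting off orthogonal elements with regular sum\<close>

context cring
begin

text \<open>Apply the Gaussian condition to \<open>p = x + y X\<close> and
  \<open>q = y + x X\<close>. As \<open>x y = 0\<close>, the product is \<open>s X\<close> with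
  \<open>s = x^2 + y^2 = (x + y)^2\<close>, and \<open>x^2\<close>, a product of coefficients, is a
  multiple \<open>e s\<close>. Then \<open>s e x = x^3 = s x\<close> and
  \<open>s e y = x^2 y = 0\<close>, and the regular \<open>s\<close> cancels.\<close>

lemma gaussian_ring_split:
  assumes gauss: "gaussian_ring R"
    and x: "x \<in> carrier R" and y: "y \<in> carrier R" and xy: "x \<otimes> y = \<zero>"
    and reg: "x \<oplus> y \<in> regular_elements R"
  obtains e where "e \<in> carrier R" "e \<otimes> x = x" "e \<otimes> y = \<zero>"
proof -
  define p where "p = (\<lambda>n::nat. if n = 0 then x else if n = 1 then y else \<zero>)"
  define q where "q = (\<lambda>n::nat. if n = 0 then y else if n = 1 then x else \<zero>)"
  have yx: "y \<otimes> x = \<zero>" using xy x y by (simp add: m_comm)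
  have p: "p \<in> up R" and q: "q \<in> up R"
    using x y by (auto simp: p_def q_def intro!: mem_upI exI[of _ "1::nat"])
  have pc: "\<And>i. p i \<in> carrier R" and qc: "\<And>i. q i \<in> carrier R" using p q by blast+
  let ?s = "x \<otimes> x \<oplus> y \<otimes> y"
  have s: "?s \<in> carrier R" using x y by simp
  have coeff: "(\<Oplus>i \<in> {..n}. p i \<otimes> q (n - i)) \<in> PIdl ?s" for n
  proof (cases "n = 1")
    case True
    \<comment> \<open>The bound is rewritten as \<open>Suc 0\<close> to make
      \<open>finsum_Suc\<close> applicable.\<close>
    have "(\<Oplus>i \<in> {..1::nat}. p i \<otimes> q (1 - i)) = (\<Oplus>i \<in> {..Suc 0}. p i \<otimes> q (1 - i))" by simp
    also have "\<dots> = y \<otimes> y \<oplus> x \<otimes> x"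
      using x y pc qc by (subst finsum_Suc) (auto simp: p_def q_def)
    also have "\<dots> = ?s" using x y by (simp add: a_comm)
    finally show ?thesis using True cgenideal_self[OF s] by simp
  next
    case False
    \<comment> \<open>The bound \<open>i \<le> n\<close> is essential: subtraction on
      \<open>nat\<close> truncates, so \<open>i = 1\<close> and \<open>n = 0\<close> would yield
      \<open>y \<otimes> y\<close>.\<close>
    have "p i \<otimes> q (n - i) = \<zero>" if "i \<le> n" for i
      using that False x y xy yx by (auto simp: p_def q_def)
    then have "(\<Oplus>i \<in> {..n}. p i \<otimes> q (n - i)) = \<zero>"
      by (intro add.finprod_one_eqI) auto
    then show ?thesis
      using cgenideal_ideal[OF s] by (simp add: additive_subgroup.zero_closed ideal.axioms(1))
  qed
  have "p 0 = x" "q 1 = x" by (simp_all add: p_def q_def)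
  then have "x \<in> range p" "x \<in> range q" by (metis rangeI)+
  then have "x \<in> Idl (range p)" "x \<in> Idl (range q)"
    using genideal_self[of "range p"] genideal_self[of "range q"] pc qc by blast+
  then have "x \<otimes> x \<in> ideal_prod R (Idl (range p)) (Idl (range q))"
    by (rule ideal_prod.prod)
  also have "\<dots> = Idl (range (\<lambda>n. \<Oplus>i \<in> {..n}. p i \<otimes> q (n - i)))"
    using gauss p q unfolding gaussian_ring_iff by simp
  also have "\<dots> \<subseteq> PIdl ?s"
    using coeff by (intro genideal_minimal cgenideal_ideal s) auto
  finally obtain e where e: "e \<in> carrier R" and xx: "x \<otimes> x = e \<otimes> ?s"
    by (auto simp: cgenideal_def)
  have reg2: "(x \<oplus> y) \<otimes> (x \<oplus> y) \<in> regular_elements R" using reg by (intro regular_mult)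
  \<comment> \<open>The mixed terms vanish, so \<open>?s\<close> is the square of a regular element
    and may be cancelled.\<close>
  have sq: "(x \<oplus> y) \<otimes> (x \<oplus> y) = ?s"
    using x y xy yx by (simp add: l_distr r_distr)
  have reg_s: "?s \<in> regular_elements R" using reg2 sq by simp
  have sx: "?s \<otimes> x = x \<otimes> x \<otimes> x" using x y yx by (simp add: l_distr m_assoc)
  have "?s \<otimes> (e \<otimes> x) = (e \<otimes> ?s) \<otimes> x" using e x s by (simp only: m_ac m_closed)
  also have "\<dots> = ?s \<otimes> x" using xx sx by simp
  finally have 1: "e \<otimes> x = x" using reg_s e x by (metis regular_cancel m_closed)
  have "?s \<otimes> (e \<otimes> y) = (e \<otimes> ?s) \<otimes> y" using e y s by (simp only: m_ac m_closed)
  also have "\<dots> = (x \<otimes> x) \<otimes> y" using xx by simp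
  also have "\<dots> = \<zero>" using x y xy by (simp add: m_assoc)
  finally have 2: "e \<otimes> y = \<zero>" using reg_s e y by (metis regular_iff m_closed)
  show ?thesis using that e 1 2 by blast
qed

text \<open>Elements of the product are sums of terms \<open>a \<otimes> k\<close> with
  \<open>a\<close> in the ideal \<open>(x, y)\<close>. The multipliers \<open>a\<close> with
  \<open>a K\<close> contained in \<open>x K + y K\<close> form an ideal containing \<open>x\<close>
  and \<open>y\<close>, hence all of \<open>(x, y)\<close>.\<close>

lemma ideal_prod_genideal_two:
  assumes x: "x \<in> carrier R" and y: "y \<in> carrier R" and K: "ideal K R"
    and z: "z \<in> ideal_prod R (Idl {x, y}) K"
  obtains k l where "k \<in> K" "l \<in> K" "z = x \<otimes> k \<oplus> y \<otimes> l"
proof -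
  interpret K: ideal K R by fact
  have "ideal {a \<in> carrier R. \<forall>k\<in>K. \<exists>k1\<in>K. \<exists>k2\<in>K. a \<otimes> k = x \<otimes> k1 \<oplus> y \<otimes> k2} R" (is "ideal ?T R")
  proof (rule idealI)
    show "ring R" by (rule ring_axioms)
    \<comment> \<open>Absorption is proved first because closure under negation reduces to it by
      multiplying with \<open>\<ominus> \<one>\<close>.\<close>
    have lin: "a \<otimes> r \<in> ?T" if "a \<in> ?T" "r \<in> carrier R" for a r
    proof -
      have "\<exists>k1\<in>K. \<exists>k2\<in>K. a \<otimes> r \<otimes> k = x \<otimes> k1 \<oplus> y \<otimes> k2" if k: "k \<in> K" for k
      proof -
        have "r \<otimes> k \<in> K" using k \<open>r \<in> carrier R\<close> by (rule K.I_l_closed)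
        then obtain k1 k2 where "k1 \<in> K" "k2 \<in> K" "a \<otimes> (r \<otimes> k) = x \<otimes> k1 \<oplus> y \<otimes> k2"
          using \<open>a \<in> ?T\<close> by blast
        then show ?thesis using \<open>a \<in> ?T\<close> \<open>r \<in> carrier R\<close> K.Icarr[OF k]
          by (auto simp: m_assoc)
      qed
      then show ?thesis using that by simp
    qed
    then show "a \<otimes> r \<in> ?T" if "a \<in> ?T" "r \<in> carrier R" for a r using that by blast
    show "r \<otimes> a \<in> ?T" if "a \<in> ?T" "r \<in> carrier R" for a r
      using lin[OF that] that by (simp add: m_comm)
    show "subgroup ?T (add_monoid R)"
    proof (rule add.subgroupI)
      show "?T \<subseteq> carrier R" by blast
      have "\<zero> \<in> ?T"
        using x y K.Icarr by (auto intro!: bexI[of _ \<zero>])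
      then show "?T \<noteq> {}" by blast
      show "\<ominus> a \<in> ?T" if "a \<in> ?T" for a
        using lin[OF that, of "\<ominus> \<one>"] that by (simp add: r_minus)
      fix a b assume a: "a \<in> ?T" and b: "b \<in> ?T"
      have "\<exists>k1\<in>K. \<exists>k2\<in>K. (a \<oplus> b) \<otimes> k = x \<otimes> k1 \<oplus> y \<otimes> k2" if k: "k \<in> K" for k
      proof -
        obtain k1 k2 where 1: "k1 \<in> K" "k2 \<in> K" "a \<otimes> k = x \<otimes> k1 \<oplus> y \<otimes> k2" using a k by blast
        obtain l1 l2 where 2: "l1 \<in> K" "l2 \<in> K" "b \<otimes> k = x \<otimes> l1 \<oplus> y \<otimes> l2" using b k by blast
        note c = 1(1,2)[THEN K.Icarr] 2(1,2)[THEN K.Icarr] K.Icarr[OF k] x y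
        have "(a \<oplus> b) \<otimes> k = x \<otimes> (k1 \<oplus> l1) \<oplus> y \<otimes> (k2 \<oplus> l2)"
          using a b 1(3) 2(3) c by (simp add: l_distr r_distr a_ac)
        then show ?thesis using 1 2 K.a_closed by blast
      qed
      then show "a \<oplus> b \<in> ?T" using a b by simp
    qed
  qed
  moreover have "{x, y} \<subseteq> ?T"
  proof -
    have "x \<otimes> k = x \<otimes> k \<oplus> y \<otimes> \<zero>" "y \<otimes> k = x \<otimes> \<zero> \<oplus> y \<otimes> k" if "k \<in> K" for k
      using x y K.Icarr[OF that] by simp_all
    then show ?thesis using x y K.zero_closed by blast
  qed
  ultimately have sub: "Idl {x, y} \<subseteq> ?T" by (rule genideal_minimal)
  have "\<exists>k\<in>K. \<exists>l\<in>K. z = x \<otimes> k \<oplus> y \<otimes> l"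
    using z
  proof induct
    case (prod i k)
    then show ?case using sub by blast
  next
    case (sum s t)
    then obtain k1 k2 l1 l2 where *: "k1 \<in> K" "k2 \<in> K" "s = x \<otimes> k1 \<oplus> y \<otimes> k2"
      "l1 \<in> K" "l2 \<in> K" "t = x \<otimes> l1 \<oplus> y \<otimes> l2" by blast
    have "s \<oplus> t = x \<otimes> (k1 \<oplus> l1) \<oplus> y \<otimes> (k2 \<oplus> l2)"
      using *(1,2,4,5)[THEN K.Icarr] *(3,6) x y by (simp add: r_distr a_ac)
    then show ?case using * K.a_closed by blast
  qed
  then show ?thesis using that by blast
qed

text \<open>By invertibility \<open>I K = (d)\<close> for \<open>I = (x, y)\<close>, so
  \<open>d = x k + y l\<close> and \<open>x k = e d\<close> for some \<open>e\<close>. With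
  \<open>x y = 0\<close> this gives \<open>d e x = d x\<close> and \<open>d e y = 0\<close>, and
  \<open>d\<close> cancels.\<close>

lemma pruefer_ring_split:
  assumes pruefer: "pruefer_ring R"
    and x: "x \<in> carrier R" and y: "y \<in> carrier R" and xy: "x \<otimes> y = \<zero>"
    and reg: "x \<oplus> y \<in> regular_elements R"
  obtains e where "e \<in> carrier R" "e \<otimes> x = x" "e \<otimes> y = \<zero>"
proof -
  let ?I = "Idl {x, y}"
  have I: "ideal ?I R" using x y by (intro genideal_ideal) auto
  have mem: "x \<in> ?I" "y \<in> ?I" using genideal_self[of "{x, y}"] x y by auto
  then have "x \<oplus> y \<in> ?I \<inter> regular_elements R"
    using reg I by (simp add: additive_subgroup.a_closed ideal.axioms(1))
  moreover have "finite {x, y}" "{x, y} \<subseteq> carrier R" using x y by auto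
  ultimately obtain K d where K: "ideal K R" and d: "d \<in> regular_elements R"
    and IK: "ideal_prod R ?I K = PIdl d"
    using pruefer unfolding pruefer_ring_iff by blast
  have dc: "d \<in> carrier R" using d by (rule regular_closed)
  have "d \<in> ideal_prod R ?I K" unfolding IK using dc by (rule cgenideal_self)
  then obtain k l where kl: "k \<in> K" "l \<in> K" and d_eq: "d = x \<otimes> k \<oplus> y \<otimes> l"
    using ideal_prod_genideal_two[OF x y K] by blast
  have klc: "k \<in> carrier R" "l \<in> carrier R" using kl K by (simp_all add: ideal.Icarr)
  have "x \<otimes> k \<in> PIdl d" unfolding IK[symmetric] using mem kl by (intro ideal_prod.prod)
  then obtain e where e: "e \<in> carrier R" and xk: "x \<otimes> k = e \<otimes> d"
    by (auto simp: cgenideal_def)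
  have "d \<otimes> (e \<otimes> x) = (x \<otimes> k) \<otimes> x" unfolding xk using e dc x by (simp add: m_ac)
  \<comment> \<open>The vanishing term \<open>(x y) l\<close> is inserted to complete
    \<open>x k x\<close> to \<open>d x\<close>.\<close>
  also have "\<dots> = (x \<otimes> k) \<otimes> x \<oplus> (x \<otimes> y) \<otimes> l" using x klc xy by simp
  also have "\<dots> = d \<otimes> x" unfolding d_eq using x y klc by (simp add: l_distr r_distr m_ac)
  finally have 1: "e \<otimes> x = x" using d e x by (metis regular_cancel m_closed)
  have "d \<otimes> (e \<otimes> y) = (x \<otimes> k) \<otimes> y" unfolding xk using e dc y by (simp add: m_ac)
  also have "\<dots> = (x \<otimes> y) \<otimes> k" using x y klc by (simp add: m_ac)
  also have "\<dots> = \<zero>" using xy klc by simp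
  finally have 2: "e \<otimes> y = \<zero>" using d e y by (metis regular_iff m_closed)
  show ?thesis using that e 1 2 by blast
qed

end


section \<open>Direct products of two rings\<close>

text \<open>Zero can be adjoined to make a set of generators nonempty without changing its ideal.
  Products of generating sets call for this, since an empty factor of \<open>T \<times> U\<close>
  erases the other one.\<close>

lemma (in ring) genideal_insert_zero:
  assumes "T \<subseteq> carrier R"
  shows "Idl (insert \<zero> T) = Idl T"
proof
  have I: "ideal (Idl T) R" using assms by (rule genideal_ideal)
  then show "Idl (insert \<zero> T) \<subseteq> Idl T"
    using genideal_self[OF assms]
    by (intro genideal_minimal) (auto simp: additive_subgroup.zero_closed ideal.axioms(1))
  show "Idl T \<subseteq> Idl (insert \<zero> T)"
    using genideal_self[of "insert \<zero> T"] assms by (intro genideal_minimal genideal_ideal) auto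
qed

text \<open>Absorption holds because surjectivity lifts every multiplier from \<open>S\<close> to
  \<open>R\<close>. The lemma is meant for the two projections of a direct product.\<close>

lemma (in ring_hom_ring) ideal_surj_image:
  assumes "ideal I R" and surj: "h ` carrier R = carrier S"
  shows "ideal (h ` I) S"
proof -
  interpret I: ideal I R by fact
  show ?thesis
  proof (rule idealI)
    show "ring S" by (rule S.ring_axioms)
    show "subgroup (h ` I) (add_monoid S)"
    proof (rule S.add.subgroupI)
      show "h ` I \<subseteq> carrier S" using I.Icarr by auto
      show "h ` I \<noteq> {}" using I.zero_closed by blast
      show "\<ominus>\<^bsub>S\<^esub> a \<in> h ` I" if "a \<in> h ` I" for a
        using that I.Icarr by (auto simp flip: hom_a_inv)
      show "a \<oplus>\<^bsub>S\<^esub> b \<in> h ` I" if "a \<in> h ` I" "b \<in> h ` I" for a b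
        using that I.Icarr by (auto simp flip: hom_add)
    qed
    fix a x assume "a \<in> h ` I" "x \<in> carrier S"
    moreover from this obtain r where "r \<in> carrier R" "x = h r" using surj by blast
    ultimately show "x \<otimes>\<^bsub>S\<^esub> a \<in> h ` I" "a \<otimes>\<^bsub>S\<^esub> x \<in> h ` I"
      using I.Icarr I.I_l_closed I.I_r_closed by (auto simp flip: hom_mult)
  qed
qed

section \<open>Sums, regular elements and ideals of a direct product\<close>

lemma RDirProd_simps [simp]:
  "carrier (RDirProd R S) = carrier R \<times> carrier S"
  "\<one>\<^bsub>RDirProd R S\<^esub> = (\<one>\<^bsub>R\<^esub>, \<one>\<^bsub>S\<^esub>)"
  "\<zero>\<^bsub>RDirProd R S\<^esub> = (\<zero>\<^bsub>R\<^esub>, \<zero>\<^bsub>S\<^esub>)"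
  "(a, b) \<otimes>\<^bsub>RDirProd R S\<^esub> (c, d) = (a \<otimes>\<^bsub>R\<^esub> c, b \<otimes>\<^bsub>S\<^esub> d)"
  "(a, b) \<oplus>\<^bsub>RDirProd R S\<^esub> (c, d) = (a \<oplus>\<^bsub>R\<^esub> c, b \<oplus>\<^bsub>S\<^esub> d)"
  by (simp_all add: RDirProd_def DirProd_def monoid.defs)

locale two_crings = R: cring R + S: cring S
  for R :: "('a, 'm) ring_scheme" and S :: "('b, 'n) ring_scheme"
begin

abbreviation P where "P \<equiv> RDirProd R S"

sublocale P: cring P
proof -
  interpret ring P by (rule RDirProd_ring) unfold_locales
  show "cring P" by unfold_locales (auto simp: R.m_comm S.m_comm)
qed

lemma finsum_RDirProd:
  assumes "finite A" "F \<in> A \<rightarrow> carrier P"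
  shows "(\<Oplus>\<^bsub>P\<^esub>i\<in>A. F i) = (\<Oplus>\<^bsub>R\<^esub>i\<in>A. fst (F i), \<Oplus>\<^bsub>S\<^esub>i\<in>A. snd (F i))"
  using assms
proof (induct A rule: finite_induct)
  case (insert a A)
  have F: "F a \<in> carrier P" "F \<in> A \<rightarrow> carrier P" using insert by auto
  then have "(\<lambda>i. fst (F i)) \<in> A \<rightarrow> carrier R" "(\<lambda>i. snd (F i)) \<in> A \<rightarrow> carrier S"
    "fst (F a) \<in> carrier R" "snd (F a) \<in> carrier S"
    by (auto simp: Pi_iff mem_Times_iff)
  then show ?case
    using insert F
    by (simp del: RDirProd_simps(1) RDirProd_add_monoid) (metis RDirProd_simps(5) prod.collapse)
qed simp

text \<open>Each component can be tested on its own by setting the other component of the multiplier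
  to zero.\<close>

lemma regular_elements_RDirProd:
  "regular_elements P = regular_elements R \<times> regular_elements S"
proof -
  have "(\<forall>y\<in>carrier R. \<forall>z\<in>carrier S. a \<otimes>\<^bsub>R\<^esub> y = \<zero>\<^bsub>R\<^esub> \<and> b \<otimes>\<^bsub>S\<^esub> z = \<zero>\<^bsub>S\<^esub> \<longrightarrow> y = \<zero>\<^bsub>R\<^esub> \<and> z = \<zero>\<^bsub>S\<^esub>)
    \<longleftrightarrow> (\<forall>y\<in>carrier R. a \<otimes>\<^bsub>R\<^esub> y = \<zero>\<^bsub>R\<^esub> \<longrightarrow> y = \<zero>\<^bsub>R\<^esub>) \<and>
        (\<forall>z\<in>carrier S. b \<otimes>\<^bsub>S\<^esub> z = \<zero>\<^bsub>S\<^esub> \<longrightarrow> z = \<zero>\<^bsub>S\<^esub>)"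
    if "a \<in> carrier R" "b \<in> carrier S" for a b
    using that R.zero_closed S.zero_closed R.r_null S.r_null by blast
  then have "(a, b) \<in> regular_elements P \<longleftrightarrow> (a, b) \<in> regular_elements R \<times> regular_elements S"
    for a b
    by (auto simp: P.regular_iff R.regular_iff S.regular_iff)
  then show ?thesis by auto
qed

lemma ideal_RDirProd:
  assumes "ideal I R" "ideal K S"
  shows "ideal (I \<times> K) P"
proof -
  interpret I: ideal I R by fact
  interpret K: ideal K S by fact
  show ?thesis
  proof (rule idealI)
    show "ring P" by (rule P.ring_axioms)
    show "subgroup (I \<times> K) (add_monoid P)"
      unfolding RDirProd_add_monoid
      by (rule DirProd_subgroups) (simp_all add: R.add.group_axioms S.add.group_axioms
          I.a_subgroup K.a_subgroup)
  qed (auto simp: I.I_l_closed I.I_r_closed K.I_l_closed K.I_r_closed)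
qed

text \<open>Multiplication by the idempotents \<open>(1, 0)\<close> and \<open>(0, 1)\<close>
  separates the components of an element within the ideal, and a sum recombines components of
  different elements. Hence every ideal of \<open>P\<close> is a product.\<close>

lemma ideal_RDirProd_eq:
  assumes "ideal I P"
  shows "ideal (fst ` I) R" "ideal (snd ` I) S" "I = fst ` I \<times> snd ` I"
proof -
  interpret I: ideal I P by fact
  have fst_mem: "(a, \<zero>\<^bsub>S\<^esub>) \<in> I" if "(a, b) \<in> I" for a b
    using I.I_l_closed[OF that, of "(\<one>\<^bsub>R\<^esub>, \<zero>\<^bsub>S\<^esub>)"] I.Icarr[OF that] by simp
  have snd_mem: "(\<zero>\<^bsub>R\<^esub>, b) \<in> I" if "(a, b) \<in> I" for a b
    using I.I_l_closed[OF that, of "(\<zero>\<^bsub>R\<^esub>, \<one>\<^bsub>S\<^esub>)"] I.Icarr[OF that] by simp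
  show "I = fst ` I \<times> snd ` I"
  proof (intro equalityI subsetI)
    fix z assume "z \<in> fst ` I \<times> snd ` I"
    then obtain a b c d where "z = (a, b)" "(a, c) \<in> I" "(d, b) \<in> I" by force
    moreover from this have "(a, \<zero>\<^bsub>S\<^esub>) \<oplus>\<^bsub>P\<^esub> (\<zero>\<^bsub>R\<^esub>, b) \<in> I"
      using fst_mem snd_mem I.a_closed by blast
    ultimately show "z \<in> I"
      using I.Icarr[of "(a, c)"] I.Icarr[of "(d, b)"] by simp
  qed force
  have hom: "ring_hom_ring P R fst" "ring_hom_ring P S snd"
    by (auto intro!: ring_hom_ringI R.ring_axioms S.ring_axioms P.ring_axioms)
  have "fst ` carrier P = carrier R" "snd ` carrier P = carrier S"
    using R.zero_closed S.zero_closed by force+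
  then show "ideal (fst ` I) R" "ideal (snd ` I) S"
    using ring_hom_ring.ideal_surj_image[OF hom(1) assms]
      ring_hom_ring.ideal_surj_image[OF hom(2) assms]
    by simp_all
qed

text \<open>The product of the two ideals is an ideal containing \<open>T\<close>. Conversely, the
  ideal generated by \<open>T\<close> is itself a product, and its factors contain the projections
  of \<open>T\<close>.\<close>

lemma genideal_RDirProd:
  assumes "T \<subseteq> carrier P"
  shows "Idl\<^bsub>P\<^esub> T = (Idl\<^bsub>R\<^esub> (fst ` T)) \<times> (Idl\<^bsub>S\<^esub> (snd ` T))"
proof
  have T: "fst ` T \<subseteq> carrier R" "snd ` T \<subseteq> carrier S" using assms by auto
  show "Idl\<^bsub>P\<^esub> T \<subseteq> (Idl\<^bsub>R\<^esub> (fst ` T)) \<times> (Idl\<^bsub>S\<^esub> (snd ` T))"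
    using R.genideal_self[OF T(1)] S.genideal_self[OF T(2)] T
    by (intro P.genideal_minimal ideal_RDirProd R.genideal_ideal S.genideal_ideal) force+
  note I = ideal_RDirProd_eq[OF P.genideal_ideal[OF assms]]
  have "Idl\<^bsub>R\<^esub> (fst ` T) \<subseteq> fst ` (Idl\<^bsub>P\<^esub> T)" "Idl\<^bsub>S\<^esub> (snd ` T) \<subseteq> snd ` (Idl\<^bsub>P\<^esub> T)"
    using P.genideal_self[OF assms]
    by (intro R.genideal_minimal S.genideal_minimal I(1,2) image_mono; assumption)+
  then show "(Idl\<^bsub>R\<^esub> (fst ` T)) \<times> (Idl\<^bsub>S\<^esub> (snd ` T)) \<subseteq> Idl\<^bsub>P\<^esub> T"
    using I(3) by blast
qed

text \<open>All four ideals contain zero, so products in one component can be padded with zeros; a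
  pair is then the sum of \<open>(a, 0)\<close> and \<open>(0, b)\<close>.\<close>

lemma ideal_prod_RDirProd:
  assumes I: "ideal I1 R" "ideal I2 S" and K: "ideal K1 R" "ideal K2 S"
  shows "ideal_prod P (I1 \<times> I2) (K1 \<times> K2) = ideal_prod R I1 K1 \<times> ideal_prod S I2 K2"
    (is "?L = ?M1 \<times> ?M2")
proof
  have L: "ideal ?L P"
    by (intro P.ideal_prod_is_ideal ideal_RDirProd assms)
  have zero: "\<zero>\<^bsub>R\<^esub> \<in> I1" "\<zero>\<^bsub>S\<^esub> \<in> I2" "\<zero>\<^bsub>R\<^esub> \<in> K1" "\<zero>\<^bsub>S\<^esub> \<in> K2"
    using assms by (simp_all add: additive_subgroup.zero_closed ideal.axioms(1))
  show "?L \<subseteq> ?M1 \<times> ?M2"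
  proof
    fix z assume "z \<in> ?L"
    then show "z \<in> ?M1 \<times> ?M2"
      by induct (auto intro: ideal_prod.intros)
  qed
  have 1: "(a, \<zero>\<^bsub>S\<^esub>) \<in> ?L" if "a \<in> ?M1" for a
    using that
  proof induct
    case (prod i k)
    have "(i, \<zero>\<^bsub>S\<^esub>) \<otimes>\<^bsub>P\<^esub> (k, \<zero>\<^bsub>S\<^esub>) \<in> ?L"
      using prod zero by (intro ideal_prod.prod) auto
    then show ?case by simp
  next
    case (sum s t)
    have "(s, \<zero>\<^bsub>S\<^esub>) \<oplus>\<^bsub>P\<^esub> (t, \<zero>\<^bsub>S\<^esub>) \<in> ?L"
      using sum by (intro ideal_prod.sum)
    then show ?case by simp
  qed
  have 2: "(\<zero>\<^bsub>R\<^esub>, b) \<in> ?L" if "b \<in> ?M2" for b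
    using that
  proof induct
    case (prod i k)
    have "(\<zero>\<^bsub>R\<^esub>, i) \<otimes>\<^bsub>P\<^esub> (\<zero>\<^bsub>R\<^esub>, k) \<in> ?L"
      using prod zero by (intro ideal_prod.prod) auto
    then show ?case by simp
  next
    case (sum s t)
    have "(\<zero>\<^bsub>R\<^esub>, s) \<oplus>\<^bsub>P\<^esub> (\<zero>\<^bsub>R\<^esub>, t) \<in> ?L"
      using sum by (intro ideal_prod.sum)
    then show ?case by simp
  qed
  show "?M1 \<times> ?M2 \<subseteq> ?L"
  proof clarify
    fix a b assume ab: "a \<in> ?M1" "b \<in> ?M2"
    have "a \<in> carrier R" "b \<in> carrier S"
      using ab R.ideal_prod_in_carrier[OF I(1) K(1)] S.ideal_prod_in_carrier[OF I(2) K(2)] by blast+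
    moreover have "(a, \<zero>\<^bsub>S\<^esub>) \<oplus>\<^bsub>P\<^esub> (\<zero>\<^bsub>R\<^esub>, b) \<in> ?L"
      using 1[OF ab(1)] 2[OF ab(2)] by (rule ideal_prod.sum)
    ultimately show "(a, b) \<in> ?L" by simp
  qed
qed

section \<open>Pruefer rings and direct products\<close>

lemma cgenideal_RDirProd: "PIdl\<^bsub>P\<^esub> (a, b) = (PIdl\<^bsub>R\<^esub> a) \<times> (PIdl\<^bsub>S\<^esub> b)"
  unfolding cgenideal_def by auto

text \<open>In the fraction-free criterion everything is componentwise: generated ideals, regular
  elements, products and principal ideals. To test one factor, its ideal is paired with the unit
  ideal of the other.\<close>

lemma pruefer_RDirProd: "pruefer_ring P \<longleftrightarrow> pruefer_ring R \<and> pruefer_ring S"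
proof
  assume P: "pruefer_ring P"
  \<comment> \<open>Nonemptiness lets \<open>T\<close> and \<open>U\<close> be recovered as the
    projections of \<open>T \<times> U\<close>; \<open>proj\<close> removes this restriction by
    adjoining zero.\<close>
  have factors: "\<exists>K d. ideal K P \<and> d \<in> regular_elements P \<and>
      ideal_prod P ((Idl\<^bsub>R\<^esub> T) \<times> (Idl\<^bsub>S\<^esub> U)) K = PIdl\<^bsub>P\<^esub> d"
    if fin: "finite T" "finite U" and car: "T \<subseteq> carrier R" "U \<subseteq> carrier S"
      and ne: "T \<noteq> {}" "U \<noteq> {}"
      and reg: "Idl\<^bsub>R\<^esub> T \<inter> regular_elements R \<noteq> {}" "Idl\<^bsub>S\<^esub> U \<inter> regular_elements S \<noteq> {}"
    for T U
  proof -
    have Idl: "Idl\<^bsub>P\<^esub> (T \<times> U) = (Idl\<^bsub>R\<^esub> T) \<times> (Idl\<^bsub>S\<^esub> U)"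
      using genideal_RDirProd[of "T \<times> U"] car ne by (simp add: Sigma_mono)
    have "Idl\<^bsub>P\<^esub> (T \<times> U) \<inter> regular_elements P \<noteq> {}"
      using reg unfolding Idl regular_elements_RDirProd by blast
    moreover have "T \<times> U \<subseteq> carrier P" using car by auto
    ultimately show ?thesis
      using P[unfolded pruefer_ring_iff, THEN conjunct2, rule_format, of "T \<times> U"] fin
      unfolding Idl by simp
  qed
  have proj: "\<exists>K1 K2 d1 d2. ideal K1 R \<and> ideal K2 S \<and> d1 \<in> regular_elements R \<and>
      d2 \<in> regular_elements S \<and> ideal_prod R (Idl\<^bsub>R\<^esub> T) K1 = PIdl\<^bsub>R\<^esub> d1 \<and>
      ideal_prod S (Idl\<^bsub>S\<^esub> U) K2 = PIdl\<^bsub>S\<^esub> d2"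
    if fin: "finite T" "finite U" and car: "T \<subseteq> carrier R" "U \<subseteq> carrier S"
      and reg: "Idl\<^bsub>R\<^esub> T \<inter> regular_elements R \<noteq> {}" "Idl\<^bsub>S\<^esub> U \<inter> regular_elements S \<noteq> {}"
    for T U
  proof -
    let ?T = "insert \<zero>\<^bsub>R\<^esub> T" and ?U = "insert \<zero>\<^bsub>S\<^esub> U"
    have T: "Idl\<^bsub>R\<^esub> ?T = Idl\<^bsub>R\<^esub> T" and U: "Idl\<^bsub>S\<^esub> ?U = Idl\<^bsub>S\<^esub> U"
      using car by (simp_all add: R.genideal_insert_zero S.genideal_insert_zero)
    obtain K d where K: "ideal K P" and d: "d \<in> regular_elements P"
      and eq: "ideal_prod P ((Idl\<^bsub>R\<^esub> T) \<times> (Idl\<^bsub>S\<^esub> U)) K = PIdl\<^bsub>P\<^esub> d"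
      using factors[of ?T ?U] fin car reg unfolding T U by auto
    obtain d1 d2 where d12: "d = (d1, d2)" by (cases d)
    note K' = ideal_RDirProd_eq[OF K]
    have "ideal_prod R (Idl\<^bsub>R\<^esub> T) (fst ` K) \<times> ideal_prod S (Idl\<^bsub>S\<^esub> U) (snd ` K) =
        ideal_prod P ((Idl\<^bsub>R\<^esub> T) \<times> (Idl\<^bsub>S\<^esub> U)) (fst ` K \<times> snd ` K)"
      by (intro ideal_prod_RDirProd[symmetric] R.genideal_ideal S.genideal_ideal car K')
    also have "\<dots> = (PIdl\<^bsub>R\<^esub> d1) \<times> (PIdl\<^bsub>S\<^esub> d2)"
      using eq unfolding K'(3)[symmetric] d12 cgenideal_RDirProd .
    finally have prod: "ideal_prod R (Idl\<^bsub>R\<^esub> T) (fst ` K) \<times> ideal_prod S (Idl\<^bsub>S\<^esub> U) (snd ` K) =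
        (PIdl\<^bsub>R\<^esub> d1) \<times> (PIdl\<^bsub>S\<^esub> d2)" .
    have d': "d1 \<in> regular_elements R" "d2 \<in> regular_elements S"
      using d unfolding d12 regular_elements_RDirProd by auto
    \<comment> \<open>An equation of products can be split into its factors once these are known to
      be nonempty, which \<open>d1\<close> and \<open>d2\<close> witness.\<close>
    have "d1 \<in> PIdl\<^bsub>R\<^esub> d1" "d2 \<in> PIdl\<^bsub>S\<^esub> d2"
      using d' by (simp_all add: R.cgenideal_self R.regular_closed S.cgenideal_self S.regular_closed)
    then have "ideal_prod R (Idl\<^bsub>R\<^esub> T) (fst ` K) = PIdl\<^bsub>R\<^esub> d1"
      "ideal_prod S (Idl\<^bsub>S\<^esub> U) (snd ` K) = PIdl\<^bsub>S\<^esub> d2"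
      using prod by (auto simp: times_eq_iff)
    then show ?thesis using K'(1,2) d' by blast
  qed
  have one: "Idl\<^bsub>R\<^esub> {\<one>\<^bsub>R\<^esub>} \<inter> regular_elements R \<noteq> {}" "Idl\<^bsub>S\<^esub> {\<one>\<^bsub>S\<^esub>} \<inter> regular_elements S \<noteq> {}"
    using R.regular_one S.regular_one R.genideal_self'[OF R.one_closed]
      S.genideal_self'[OF S.one_closed] by blast+
  have "\<exists>K d. ideal K R \<and> d \<in> regular_elements R \<and> ideal_prod R (Idl\<^bsub>R\<^esub> T) K = PIdl\<^bsub>R\<^esub> d"
    if "finite T" "T \<subseteq> carrier R" "Idl\<^bsub>R\<^esub> T \<inter> regular_elements R \<noteq> {}" for T
    using proj[of T "{\<one>\<^bsub>S\<^esub>}"] that one by simp metis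
  moreover have "\<exists>K d. ideal K S \<and> d \<in> regular_elements S \<and> ideal_prod S (Idl\<^bsub>S\<^esub> U) K = PIdl\<^bsub>S\<^esub> d"
    if "finite U" "U \<subseteq> carrier S" "Idl\<^bsub>S\<^esub> U \<inter> regular_elements S \<noteq> {}" for U
    using proj[of "{\<one>\<^bsub>R\<^esub>}" U] that one by simp metis
  ultimately show "pruefer_ring R \<and> pruefer_ring S"
    unfolding pruefer_ring_iff using R.is_cring S.is_cring by simp
next
  assume RS: "pruefer_ring R \<and> pruefer_ring S"
  have "\<exists>K d. ideal K P \<and> d \<in> regular_elements P \<and> ideal_prod P (Idl\<^bsub>P\<^esub> T) K = PIdl\<^bsub>P\<^esub> d"
    if fin: "finite T" and car: "T \<subseteq> carrier P" and reg: "Idl\<^bsub>P\<^esub> T \<inter> regular_elements P \<noteq> {}"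
    for T
  proof -
    have T: "finite (fst ` T)" "finite (snd ` T)" "fst ` T \<subseteq> carrier R" "snd ` T \<subseteq> carrier S"
      using fin car by auto
    have "Idl\<^bsub>R\<^esub> (fst ` T) \<inter> regular_elements R \<noteq> {}" "Idl\<^bsub>S\<^esub> (snd ` T) \<inter> regular_elements S \<noteq> {}"
      using reg unfolding genideal_RDirProd[OF car] regular_elements_RDirProd by auto
    then obtain K1 d1 K2 d2 where
      1: "ideal K1 R" "d1 \<in> regular_elements R" "ideal_prod R (Idl\<^bsub>R\<^esub> (fst ` T)) K1 = PIdl\<^bsub>R\<^esub> d1" and
      2: "ideal K2 S" "d2 \<in> regular_elements S" "ideal_prod S (Idl\<^bsub>S\<^esub> (snd ` T)) K2 = PIdl\<^bsub>S\<^esub> d2"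
      using RS T unfolding pruefer_ring_iff by meson
    \<comment> \<open>Witnesses for the two projections of \<open>T\<close> combine into a witness
      for \<open>T\<close>.\<close>
    have "ideal_prod P (Idl\<^bsub>P\<^esub> T) (K1 \<times> K2) = PIdl\<^bsub>P\<^esub> (d1, d2)"
      unfolding genideal_RDirProd[OF car] cgenideal_RDirProd 1(3)[symmetric] 2(3)[symmetric]
      by (intro ideal_prod_RDirProd R.genideal_ideal S.genideal_ideal T 1 2)
    then show ?thesis
      using ideal_RDirProd[OF 1(1) 2(1)] 1(2) 2(2) unfolding regular_elements_RDirProd by blast
  qed
  then show "pruefer_ring P"
    unfolding pruefer_ring_iff using P.is_cring by blast
qed

section \<open>Gaussian rings and direct products\<close>

lemma up_RDirProd:
  "h \<in> up P \<longleftrightarrow> (\<lambda>n. fst (h n)) \<in> up R \<and> (\<lambda>n. snd (h n)) \<in> up S"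
proof
  assume "h \<in> up P"
  then obtain n where "\<And>m. h m \<in> carrier P" "bound \<zero>\<^bsub>P\<^esub> n h" by (auto simp: up_def)
  then show "(\<lambda>n. fst (h n)) \<in> up R \<and> (\<lambda>n. snd (h n)) \<in> up S"
    by (auto simp: bound_def mem_Times_iff intro!: mem_upI exI[of _ n])
next
  assume h: "(\<lambda>n. fst (h n)) \<in> up R \<and> (\<lambda>n. snd (h n)) \<in> up S"
  then obtain n m where "bound \<zero>\<^bsub>R\<^esub> n (\<lambda>n. fst (h n))" "bound \<zero>\<^bsub>S\<^esub> m (\<lambda>n. snd (h n))"
    by (auto simp: up_def)
  \<comment> \<open>Beyond the larger of the two bounds both components vanish.\<close>
  then have "bound \<zero>\<^bsub>P\<^esub> (max n m) h"
    by (auto simp: bound_def prod_eq_iff)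
  moreover have "h k \<in> carrier P" for k
    using h by (auto simp: mem_Times_iff)
  ultimately show "h \<in> up P" by blast
qed

text \<open>Coefficients of products, contents and products of ideals are all formed componentwise,
  so the content formula over \<open>P\<close> is the conjunction of those over \<open>R\<close> and
  \<open>S\<close>. A polynomial over one factor is extended by the zero polynomial over the
  other.\<close>

lemma gaussian_RDirProd: "gaussian_ring P \<longleftrightarrow> gaussian_ring R \<and> gaussian_ring S"
proof -
  \<comment> \<open>\<open>?c\<close> is the content, \<open>?m\<close> the coefficient sequence of
    the product, and \<open>?E\<close> the content formula for one pair of polynomials.\<close>
  let ?c = "\<lambda>T p. Idl\<^bsub>T\<^esub> (range p)"
  let ?m = "\<lambda>T p q n. \<Oplus>\<^bsub>T\<^esub>i \<in> {..n}. p i \<otimes>\<^bsub>T\<^esub> q (n - i)"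
  let ?E = "\<lambda>T p q. ?c T (?m T p q) = ideal_prod T (?c T p) (?c T q)"
  have content: "?c P h = ?c R (\<lambda>n. fst (h n)) \<times> ?c S (\<lambda>n. snd (h n))" if "h \<in> up P" for h
    using genideal_RDirProd[of "range h"] mem_upD[OF that]
    by (auto simp: image_image image_subset_iff)
  have ideals: "ideal (?c R p) R" if "p \<in> up R" for p
    using that by (intro R.genideal_ideal) auto
  have ideals': "ideal (?c S p) S" if "p \<in> up S" for p
    using that by (intro S.genideal_ideal) auto
  have key: "?E P h k \<longleftrightarrow> ?E R (\<lambda>n. fst (h n)) (\<lambda>n. fst (k n)) \<and> ?E S (\<lambda>n. snd (h n)) (\<lambda>n. snd (k n))"
    if h: "h \<in> up P" and k: "k \<in> up P" for h k
  proof -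
    note h' = h[unfolded up_RDirProd] and k' = k[unfolded up_RDirProd]
    have hc: "h i \<in> carrier P" "k i \<in> carrier P" for i using h k by blast+
    have mult: "h i \<otimes>\<^bsub>P\<^esub> k j = (fst (h i) \<otimes>\<^bsub>R\<^esub> fst (k j), snd (h i) \<otimes>\<^bsub>S\<^esub> snd (k j))" for i j
      by (metis RDirProd_simps(4) prod.collapse)
    have m: "?m P h k n = (?m R (\<lambda>n. fst (h n)) (\<lambda>n. fst (k n)) n, ?m S (\<lambda>n. snd (h n)) (\<lambda>n. snd (k n)) n)"
      for n
    proof -
      have "?m P h k n = (\<Oplus>\<^bsub>R\<^esub>i\<in>{..n}. fst (h i \<otimes>\<^bsub>P\<^esub> k (n - i)), \<Oplus>\<^bsub>S\<^esub>i\<in>{..n}. snd (h i \<otimes>\<^bsub>P\<^esub> k (n - i)))"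
        using hc by (intro finsum_RDirProd) (auto simp del: RDirProd_simps(1))
      then show ?thesis by (simp add: mult)
    qed
    have "?m P h k \<in> up P" using h k by (rule P.up_mult_closed)
    from content[OF this]
    have "?c P (?m P h k) = ?c R (?m R (\<lambda>n. fst (h n)) (\<lambda>n. fst (k n))) \<times>
        ?c S (?m S (\<lambda>n. snd (h n)) (\<lambda>n. snd (k n)))"
      by (simp only: m fst_conv snd_conv)
    moreover have "ideal_prod P (?c P h) (?c P k) =
        ideal_prod R (?c R (\<lambda>n. fst (h n))) (?c R (\<lambda>n. fst (k n))) \<times>
        ideal_prod S (?c S (\<lambda>n. snd (h n))) (?c S (\<lambda>n. snd (k n)))"
      unfolding content[OF h] content[OF k]
      using h' k' by (intro ideal_prod_RDirProd ideals ideals') auto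
    \<comment> \<open>Contents contain zero, so these factors are nonempty and the equation of
      products can be split.\<close>
    moreover have "?c R (?m R (\<lambda>n. fst (h n)) (\<lambda>n. fst (k n))) \<noteq> {}"
      "?c S (?m S (\<lambda>n. snd (h n)) (\<lambda>n. snd (k n))) \<noteq> {}"
      using ideals[OF R.up_mult_closed, of "\<lambda>n. fst (h n)" "\<lambda>n. fst (k n)"]
        ideals'[OF S.up_mult_closed, of "\<lambda>n. snd (h n)" "\<lambda>n. snd (k n)"] h' k'
        additive_subgroup.zero_closed ideal.axioms(1) by blast+
    ultimately show ?thesis by (auto simp: times_eq_iff)
  qed
  have zero: "(\<lambda>_. \<zero>\<^bsub>R\<^esub>) \<in> up R" "(\<lambda>_. \<zero>\<^bsub>S\<^esub>) \<in> up S" by auto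
  have "(\<forall>h\<in>up P. \<forall>k\<in>up P. ?E P h k) \<longleftrightarrow>
      (\<forall>p\<in>up R. \<forall>q\<in>up R. ?E R p q) \<and> (\<forall>p\<in>up S. \<forall>q\<in>up S. ?E S p q)" (is "?A \<longleftrightarrow> ?B1 \<and> ?B2")
  proof (intro iffI conjI ballI)
    fix p q assume A: ?A and pq: "p \<in> up R" "q \<in> up R"
    let ?p = "\<lambda>n. (p n, \<zero>\<^bsub>S\<^esub>)" and ?q = "\<lambda>n. (q n, \<zero>\<^bsub>S\<^esub>)"
    have up: "?p \<in> up P" "?q \<in> up P" using pq zero by (simp_all add: up_RDirProd)
    then have "?E P ?p ?q" using A[rule_format, of ?p ?q] by simp
    then show "?E R p q" unfolding key[OF up] by (simp only: fst_conv)
  next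
    fix p q assume A: ?A and pq: "p \<in> up S" "q \<in> up S"
    let ?p = "\<lambda>n. (\<zero>\<^bsub>R\<^esub>, p n)" and ?q = "\<lambda>n. (\<zero>\<^bsub>R\<^esub>, q n)"
    have up: "?p \<in> up P" "?q \<in> up P" using pq zero by (simp_all add: up_RDirProd)
    then have "?E P ?p ?q" using A[rule_format, of ?p ?q] by simp
    then show "?E S p q" unfolding key[OF up] by (simp only: snd_conv)
  next
    fix h k assume "?B1 \<and> ?B2" and hk: "h \<in> up P" "k \<in> up P"
    then show "?E P h k"
      unfolding key[OF hk] using hk[unfolded up_RDirProd]
      by (intro conjI) (elim conjE, drule bspec, assumption, drule bspec, assumption, assumption)+
  qed
  then show ?thesis
    unfolding gaussian_ring_iff using R.is_cring S.is_cring P.is_cring by simp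
qed

end


section \<open>Bi-amalgamations\<close>

theorem theorem2p1:
  fixes A :: "('a, 'k) ring_scheme"
    and B :: "('b, 'l) ring_scheme"
    and C :: "('c, 'm) ring_scheme"
    and f :: "'a \<Rightarrow> 'b" and g :: "'a \<Rightarrow> 'c"
    and J :: "'b set" and J' :: "'c set"
  assumes "cring A" and "cring B" and "cring C"
    and "f \<in> ring_hom A B" and "g \<in> ring_hom A C"
    and "ideal J B" and "ideal J' C"
    and "{a \<in> carrier A. f a \<in> J} = {a \<in> carrier A. g a \<in> J'}"
    and "regular_ideal (RDirProd (image_plus_ideal A B f J) (image_plus_ideal A C g J')) (J \<times> J')"
  shows "(gaussian_ring (bi_amalgamation A B C f g J J') \<longleftrightarrow>
            J = carrier B \<and> J' = carrier C \<and> gaussian_ring B \<and> gaussian_ring C) \<and>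
         (pruefer_ring (bi_amalgamation A B C f g J J') \<longleftrightarrow>
            J = carrier B \<and> J' = carrier C \<and> pruefer_ring B \<and> pruefer_ring C)"
proof -
  let ?D = "bi_amalgamation A B C f g J J'"
  let ?FJ = "image_plus_ideal A B f J" and ?GJ = "image_plus_ideal A C g J'"
  interpret A: cring A by fact
  interpret B: cring B by fact
  interpret C: cring C by fact
  interpret BC: two_crings B C by unfold_locales
  interpret f: ring_hom_cring A B f by (intro ring_hom_cringI assms)
  interpret g: ring_hom_cring A C g by (intro ring_hom_cringI assms)
  interpret J: ideal J B by fact
  interpret J': ideal J' C by fact
  have D: "carrier ?D = {(f a \<oplus>\<^bsub>B\<^esub> j, g a \<oplus>\<^bsub>C\<^esub> j') | a j j'. a \<in> carrier A \<and> j \<in> J \<and> j' \<in> J'}"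
    "monoid.mult ?D = monoid.mult (RDirProd B C)" "ring.add ?D = ring.add (RDirProd B C)"
    "\<zero>\<^bsub>?D\<^esub> = (\<zero>\<^bsub>B\<^esub>, \<zero>\<^bsub>C\<^esub>)"
    by (simp_all add: bi_amalgamation_def)
  \<comment> \<open>Taking \<open>a = 0\<close> shows that \<open>J \<times> J'\<close> lies in the
    bi-amalgamation.\<close>
  have JJ_sub: "(j, j') \<in> carrier ?D" if "j \<in> J" "j' \<in> J'" for j j'
  proof -
    have "(j, j') = (f \<zero>\<^bsub>A\<^esub> \<oplus>\<^bsub>B\<^esub> j, g \<zero>\<^bsub>A\<^esub> \<oplus>\<^bsub>C\<^esub> j')" using that J.Icarr J'.Icarr by simp
    then show ?thesis unfolding D using that A.zero_closed by blast
  qed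
  have FJ: "carrier ?FJ = {f a \<oplus>\<^bsub>B\<^esub> j | a j. a \<in> carrier A \<and> j \<in> J}"
    "monoid.mult ?FJ = monoid.mult B" "\<zero>\<^bsub>?FJ\<^esub> = \<zero>\<^bsub>B\<^esub>"
    by (simp_all add: image_plus_ideal_def)
  have GJ: "carrier ?GJ = {g a \<oplus>\<^bsub>C\<^esub> j | a j. a \<in> carrier A \<and> j \<in> J'}"
    "monoid.mult ?GJ = monoid.mult C" "\<zero>\<^bsub>?GJ\<^esub> = \<zero>\<^bsub>C\<^esub>"
    by (simp_all add: image_plus_ideal_def)
  \<comment> \<open>Regularity is assumed in the larger ring; through this inclusion it passes to
    elements of the bi-amalgamation.\<close>
  have D_sub: "carrier ?D \<subseteq> carrier ?FJ \<times> carrier ?GJ"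
    unfolding D FJ GJ by blast
  \<comment> \<open>The Gaussian or Pruefer condition enters only through \<open>split\<close>, so
    one argument serves both equivalences.\<close>
  have collapse: "J = carrier B \<and> J' = carrier C"
    if D_cring: "cring ?D"
      and split: "\<And>x y. x \<in> carrier ?D \<Longrightarrow> y \<in> carrier ?D \<Longrightarrow> x \<otimes>\<^bsub>?D\<^esub> y = \<zero>\<^bsub>?D\<^esub> \<Longrightarrow>
        x \<oplus>\<^bsub>?D\<^esub> y \<in> regular_elements ?D \<Longrightarrow>
        \<exists>e\<in>carrier ?D. e \<otimes>\<^bsub>?D\<^esub> x = x \<and> e \<otimes>\<^bsub>?D\<^esub> y = \<zero>\<^bsub>?D\<^esub>"
  proof -
    interpret D: cring ?D by fact
    obtain j j' where j: "j \<in> J" "j' \<in> J'"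
      and nzd: "\<not> zero_divisor (RDirProd ?FJ ?GJ) (j, j')"
      and mem: "j \<in> carrier ?FJ" "j' \<in> carrier ?GJ"
      using assms(9) unfolding regular_ideal_def regular_elements_def by auto
    have jc: "j \<in> carrier B" "j' \<in> carrier C" using j J.Icarr J'.Icarr by auto
    have reg: "u = \<zero>\<^bsub>B\<^esub> \<and> v = \<zero>\<^bsub>C\<^esub>"
      if "u \<in> carrier ?FJ" "v \<in> carrier ?GJ" "j \<otimes>\<^bsub>B\<^esub> u = \<zero>\<^bsub>B\<^esub>" "j' \<otimes>\<^bsub>C\<^esub> v = \<zero>\<^bsub>C\<^esub>" for u v
      using nzd mem that unfolding zero_divisor_def by (auto simp: FJ(2,3) GJ(2,3))
    define x where "x = (j, \<zero>\<^bsub>C\<^esub>)"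
    define y where "y = (\<zero>\<^bsub>B\<^esub>, j')"
    have x: "x \<in> carrier ?D" and y: "y \<in> carrier ?D"
      unfolding x_def y_def using j by (auto intro!: JJ_sub)
    have sum: "x \<oplus>\<^bsub>?D\<^esub> y = (j, j')" unfolding D x_def y_def using jc by simp
    have "x \<oplus>\<^bsub>?D\<^esub> y \<in> regular_elements ?D"
      unfolding D.regular_iff
    proof (intro conjI ballI impI)
      show "x \<oplus>\<^bsub>?D\<^esub> y \<in> carrier ?D" using x y by simp
      fix z assume z: "z \<in> carrier ?D" "(x \<oplus>\<^bsub>?D\<^esub> y) \<otimes>\<^bsub>?D\<^esub> z = \<zero>\<^bsub>?D\<^esub>"
      obtain u v where uv: "z = (u, v)" by (cases z)
      have "u \<in> carrier ?FJ" "v \<in> carrier ?GJ" using z D_sub uv by blast+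
      moreover have "j \<otimes>\<^bsub>B\<^esub> u = \<zero>\<^bsub>B\<^esub>" "j' \<otimes>\<^bsub>C\<^esub> v = \<zero>\<^bsub>C\<^esub>"
        using z(2) unfolding sum uv D(2,4) by simp_all
      ultimately show "z = \<zero>\<^bsub>?D\<^esub>" using reg uv D(4) by simp
    qed
    moreover have "x \<otimes>\<^bsub>?D\<^esub> y = \<zero>\<^bsub>?D\<^esub>" unfolding D x_def y_def using jc by simp
    ultimately obtain e where e: "e \<in> carrier ?D" "e \<otimes>\<^bsub>?D\<^esub> x = x" "e \<otimes>\<^bsub>?D\<^esub> y = \<zero>\<^bsub>?D\<^esub>"
      using split x y by blast
    obtain a i i' where a: "a \<in> carrier A" and i: "i \<in> J" "i' \<in> J'"
      and e_eq: "e = (f a \<oplus>\<^bsub>B\<^esub> i, g a \<oplus>\<^bsub>C\<^esub> i')"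
      using e(1) unfolding D by blast
    note ic = J.Icarr[OF i(1)] J'.Icarr[OF i(2)]
    \<comment> \<open>Componentwise, \<open>e\<close> fixes \<open>j\<close> and annihilates
      \<open>j'\<close>.\<close>
    have e1: "(f a \<oplus>\<^bsub>B\<^esub> i) \<otimes>\<^bsub>B\<^esub> j = j" and e2: "(g a \<oplus>\<^bsub>C\<^esub> i') \<otimes>\<^bsub>C\<^esub> j' = \<zero>\<^bsub>C\<^esub>"
      using e(2,3) unfolding D(2,4) x_def y_def e_eq by simp_all
    \<comment> \<open>Write \<open>e = (u, v)\<close>. Then \<open>f w - i = 1 - u\<close> kills
      \<open>j\<close> and lies in \<open>f(A) + J\<close>, while \<open>v\<close> kills
      \<open>j'\<close> and lies in \<open>g(A) + J'\<close>. Regularity in the product of these two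
      rings forces \<open>u = 1\<close> and \<open>v = 0\<close>; the pair \<open>(1 - u, v)\<close>
      is not known to lie in the bi-amalgamation.\<close>
    define w where "w = \<one>\<^bsub>A\<^esub> \<ominus>\<^bsub>A\<^esub> a"
    have w: "w \<in> carrier A" "f w = \<one>\<^bsub>B\<^esub> \<ominus>\<^bsub>B\<^esub> f a" using a by (simp_all add: w_def a_minus_def)
    have one_minus: "f w \<oplus>\<^bsub>B\<^esub> (\<ominus>\<^bsub>B\<^esub> i) = \<one>\<^bsub>B\<^esub> \<ominus>\<^bsub>B\<^esub> (f a \<oplus>\<^bsub>B\<^esub> i)"
      using a ic w by (simp add: a_minus_def B.minus_add B.a_ac)
    have "f w \<oplus>\<^bsub>B\<^esub> (\<ominus>\<^bsub>B\<^esub> i) \<in> carrier ?FJ" unfolding FJ using w i by blast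
    moreover have "g a \<oplus>\<^bsub>C\<^esub> i' \<in> carrier ?GJ" unfolding GJ using a i by blast
    moreover have "j \<otimes>\<^bsub>B\<^esub> (f w \<oplus>\<^bsub>B\<^esub> (\<ominus>\<^bsub>B\<^esub> i)) = j \<ominus>\<^bsub>B\<^esub> (f a \<oplus>\<^bsub>B\<^esub> i) \<otimes>\<^bsub>B\<^esub> j"
      unfolding one_minus using jc a ic
      by (simp add: a_minus_def B.r_distr B.r_minus B.m_comm del: B.minus_add)
    then have "j \<otimes>\<^bsub>B\<^esub> (f w \<oplus>\<^bsub>B\<^esub> (\<ominus>\<^bsub>B\<^esub> i)) = \<zero>\<^bsub>B\<^esub>"
      unfolding e1 using jc by (simp add: a_minus_def B.r_neg)
    moreover have "j' \<otimes>\<^bsub>C\<^esub> (g a \<oplus>\<^bsub>C\<^esub> i') = \<zero>\<^bsub>C\<^esub>"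
      using e2 jc a ic by (simp add: C.m_comm)
    ultimately have w0: "f w \<oplus>\<^bsub>B\<^esub> (\<ominus>\<^bsub>B\<^esub> i) = \<zero>\<^bsub>B\<^esub>" and ga: "g a \<oplus>\<^bsub>C\<^esub> i' = \<zero>\<^bsub>C\<^esub>"
      using reg by blast+
    \<comment> \<open>From \<open>v = 0\<close>, \<open>g a\<close> lies in \<open>J'\<close>, and
      the equality of preimages puts \<open>f a\<close> in \<open>J\<close>. From
      \<open>u = 1\<close>, \<open>f w\<close> lies in \<open>J\<close>, hence \<open>g w\<close> in
      \<open>J'\<close>. As \<open>w + a = 1\<close>, both ideals contain one.\<close>
    have "g a = \<ominus>\<^bsub>C\<^esub> i'" using ga a ic by (metis C.minus_equality g.hom_closed)
    then have gaJ: "g a \<in> J'" using i by simp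
    then have faJ: "f a \<in> J" using a assms(8) by blast
    have "f w = i" using w0 w(1) ic by (metis B.add.inv_closed B.minus_equality B.minus_minus f.hom_closed)
    then have fwJ: "f w \<in> J" using i by simp
    then have gwJ: "g w \<in> J'" using w assms(8) by blast
    have aw: "w \<oplus>\<^bsub>A\<^esub> a = \<one>\<^bsub>A\<^esub>" using a by (simp add: w_def a_minus_def A.a_assoc A.l_neg)
    have "f w \<oplus>\<^bsub>B\<^esub> f a = \<one>\<^bsub>B\<^esub>" "g w \<oplus>\<^bsub>C\<^esub> g a = \<one>\<^bsub>C\<^esub>"
      using aw w(1) a by (metis f.hom_add f.hom_one, metis g.hom_add g.hom_one)
    then have "\<one>\<^bsub>B\<^esub> \<in> J" "\<one>\<^bsub>C\<^esub> \<in> J'"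
      using faJ fwJ gaJ gwJ by (metis J.a_closed, metis J'.a_closed)
    then show ?thesis using J.one_imp_carrier J'.one_imp_carrier by blast
  qed
  \<comment> \<open>This is an equality of records, since the carriers agree and the operations are
    those of \<open>RDirProd B C\<close>; the results on direct products then apply
    verbatim.\<close>
  have full: "?D = RDirProd B C" if "J = carrier B" "J' = carrier C"
  proof -
    have "carrier ?D \<subseteq> carrier B \<times> carrier C"
      unfolding D using J.Icarr J'.Icarr by auto
    then have "carrier ?D = carrier (RDirProd B C)" using JJ_sub that by auto
    then show ?thesis by (simp add: bi_amalgamation_def)
  qed
  have "J = carrier B \<and> J' = carrier C" if "gaussian_ring ?D"
  proof -
    have "cring ?D" using that by (simp add: gaussian_ring_def)
    then show ?thesis using cring.gaussian_ring_split[OF _ that] by (intro collapse) metis+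
  qed
  moreover have "J = carrier B \<and> J' = carrier C" if "pruefer_ring ?D"
  proof -
    have "cring ?D" using that by (simp add: pruefer_ring_def)
    then show ?thesis using cring.pruefer_ring_split[OF _ that] by (intro collapse) metis+
  qed
  \<comment> \<open>If both ideals are the whole rings, the bi-amalgamation is the direct product
    and the componentwise criteria apply; otherwise both sides of each equivalence fail.\<close>
  ultimately show ?thesis
    using full BC.gaussian_RDirProd BC.pruefer_RDirProd by metis
qed

end
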